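(* Consider the multinomial choice model described in the context. Suppose: (1) $p_0(x)=\Pr(\mathbf y=0\mid\mathbf x=x)$ is known (identified) for all $x\in X$. (2) For all $w\in W$: $\boldsymbol\varepsilon$ is conditionally independent of $(\mathbf e,\mathbf d,\mathbf z)$ conditional on $\mathbf w=w$, and $\mathbf e$ is conditionally independent of $(\mathbf d,\mathbf z)$ conditional on $\mathbf w=w$. (3) For all $w\in W$: (i) conditional on $\mathbf w=w$, $\mathbf e$ is a standard normal random variable; (ii) there exists $(d^*,z^* )$ in the interior of the support of $(\mathbf d,\mathbf z)$ conditional on $\mathbf w=w$ such that $z^*_y>0$ for all $y\in Y\setminus\{0\}$; (iii) there exists $(d^{**},z^{**})$ in the interior of the support of $(\mathbf d,\mathbf z)$ conditional on $\mathbf w=w$ such that $p_0((d,z^{**},w))$ is neither an exponential nor an affine function of $d$ on some open set. Then: (i) $\beta_0(w)$ and $\beta_1(w)$ are identified for all $w\in W$; (ii) with $\mathbf v=\beta_0(\mathbf w)+\beta_1(\mathbf w)\mathbf d+\mathbf e$, the conditional c.d.f. $F_{\mathbf v|\mathbf x}$ is identified and the family $\{F_{\mathbf v|\mathbf x}(\cdot|(d,z,w)),\ d\in D_{(z,w)}\}$ is boundedly complete for all $(z,w)$ in the support of $(\mathbf z,\mathbf w)$.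
   Context: Model. An agent chooses $\mathbf y\in Y=\{0,1,\dots,J\}$ to maximize utility. The utility of $y=0$ is normalized to $0$; the utility of $y\ne0$ is $$\mathbf z_y\big[\beta_0(\mathbf w)+\beta_1(\mathbf w)\mathbf d+\mathbf e\big]+\boldsymbol\varepsilon_y .$$ Here $\mathbf z=(\mathbf z_y)_{y\ne0}\in\mathbb R^J$, $\mathbf d\in\mathbb R$ and $\mathbf w\in W\subseteq\mathbb R^{d_w}$ are observed covariates; $\mathbf x=(\mathbf d,\mathbf z,\mathbf w)$ has support $X$; $\mathbf e\in\mathbb R$ and $\boldsymbol\varepsilon=(\boldsymbol\varepsilon_y)_{y\neq0}\in\mathbb R^J$ are latent; $\beta_0,\beta_1:W\to\mathbb R$ are unknown functions with $\beta_1(w)\ne0$ for all $w\in W$. Ties with the outside option are resolved in favor of $0$, so that, under the conditional independence assumptions, $$p_0(d,z,w)=\int F_{\boldsymbol\varepsilon|\mathbf w}\big(-z_1(\beta_0(w)+\beta_1(w)d+e),\dots,-z_J(\beta_0(w)+\beta_1(w)d+e)\,\big|\,w\big)\,dF_{\mathbf e|\mathbf w}(e|w).$$ An exponential function of $d$ is one of the form $K_1e^{K_3d}+K_2$ and an affine function of $d$ is one of the form $K_1d+K_2$, with constants $K_1,K_2,K_3$ (not depending on $d$). $D_{(z,w)}$ is the support of $\mathbf d$ conditional on $(\mathbf z,\mathbf w)=(z,w)$. Bounded completeness. The family $\{F_{\mathbf v|\mathbf x}(\cdot|x),x\in X'\}$ is boundedly complete if for any bounded function $g$: $\int g(t)\,dF_{\mathbf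 v|\mathbf x}(t|x)=0$ for all $x\in X'$ implies $g(\mathbf v)=0$ a.s. Identification. A feature of the model (a function of the structure $(\beta_0,\beta_1,F_{\boldsymbol\varepsilon|\mathbf w})$) is identified if any two structures satisfying all the stated assumptions and generating the same $p_0$ on $X$ have the same value of that feature.
   Formalization: Bounded completeness in (ii) is proved only for those (z,w) in the support for which D_(z,w) has a limit point; as stated it fails, e.g. when D_(z,w) is a single point (an atom of (d,z) away from the region where (3) holds), since one normal law is not boundedly complete. *)

theory Defs
  imports "HOL-Probability.Probability"
begin

section \<open>Primitives\<close>

text \<open>
  The choice set is \<open>Y = 'j option\<close>: \<open>None\<close> is the outside option \<open>0\<close> and \<open>Some j\<close> with
  \<open>j :: 'j\<close> are the remaining alternatives, so \<open>J = CARD('j)\<close>. Everything random is described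
  conditionally on \<open>w\<close>: an outcome is \<open>((d, z), (e, eps))\<close>, and \<open>law S w\<close> is the joint
  distribution of \<open>((d, z), (e, eps))\<close> conditional on the covariate being equal to \<open>w\<close>.
\<close>

type_synonym 'j outcome = "(real \<times> (real, 'j) vec) \<times> (real \<times> (real, 'j) vec)"

record ('j, 'k) dc_model =
  beta0 :: "real^'k \<Rightarrow> real"
  beta1 :: "real^'k \<Rightarrow> real"
  law :: "real^'k \<Rightarrow> 'j outcome measure"

definition DZ :: "'j::finite outcome \<Rightarrow> real \<times> (real^'j)" where
  "DZ \<omega> = fst \<omega>"

definition Lat :: "'j::finite outcome \<Rightarrow> real" where
  "Lat \<omega> = fst (snd \<omega>)"

definition Shock :: "'j::finite outcome \<Rightarrow> real^'j" where
  "Shock \<omega> = snd (snd \<omega>)"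

definition utility ::
    "('j::finite, 'k::finite) dc_model \<Rightarrow> real^'k \<Rightarrow> 'j outcome \<Rightarrow> 'j option \<Rightarrow> real" where
  "utility S w \<omega> y = (case y of
      None \<Rightarrow> 0
    | Some j \<Rightarrow> snd (DZ \<omega>) $ j * (beta0 S w + beta1 S w * fst (DZ \<omega>) + Lat \<omega>) + Shock \<omega> $ j)"

text \<open>The weak inequality is the tie-breaking rule in favour of the outside option.\<close>

definition outside_chosen :: "('j::finite, 'k::finite) dc_model \<Rightarrow> real^'k \<Rightarrow> 'j outcome \<Rightarrow> bool" where
  "outside_chosen S w \<omega> \<longleftrightarrow> (\<forall>y. utility S w \<omega> y \<le> utility S w \<omega> None)"


section \<open>Conditional laws of the latent variables, \<open>p\<^sub>0\<close> and \<open>v\<close>\<close>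

definition lat_law :: "('j::finite, 'k::finite) dc_model \<Rightarrow> real^'k \<Rightarrow> real measure" where
  "lat_law S w = distr (law S w) borel Lat"

definition eps_cdf :: "('j::finite, 'k::finite) dc_model \<Rightarrow> real^'k \<Rightarrow> real^'j \<Rightarrow> real" where
  "eps_cdf S w a = measure (distr (law S w) borel Shock) {u. \<forall>j. u $ j \<le> a $ j}"

text \<open>
  Conditional probabilities given \<open>x = (d, z, w)\<close> are only determined up to null sets; as in the
  model description, \<open>p0\<close> is the version given by the explicit integral (and \<open>v_law\<close> below the
  version obtained by fixing \<open>d\<close> in \<open>v\<close>). The lemmas \<open>p0_conditional_probability\<close> and
  \<open>v_law_conditional_law\<close> at the end show that under the conditional independence assumptions
  these are indeed versions of the probability of choosing the outside option and of the
  distribution of \<open>v\<close> given \<open>x\<close>.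
\<close>

definition p0 :: "('j::finite, 'k::finite) dc_model \<Rightarrow> real \<times> (real^'j) \<times> (real^'k) \<Rightarrow> real" where
  "p0 S = (\<lambda>(d, z, w).
     \<integral>e. eps_cdf S w (\<chi> j. - z $ j * (beta0 S w + beta1 S w * d + e)) \<partial>lat_law S w)"

definition v_law :: "('j::finite, 'k::finite) dc_model \<Rightarrow> real \<times> (real^'j) \<times> (real^'k) \<Rightarrow> real measure" where
  "v_law S = (\<lambda>(d, z, w). distr (lat_law S w) borel (\<lambda>e. beta0 S w + beta1 S w * d + e))"


section \<open>Supports\<close>

definition supp :: "'a::topological_space measure \<Rightarrow> 'a set" where
  "supp M = {x. \<forall>U. open U \<longrightarrow> x \<in> U \<longrightarrow> emeasure M U > 0}"

text \<open>
  \<open>R w\<close> is the distribution of \<open>(d, z)\<close> conditional on \<open>w\<close>; the support of \<open>x\<close> is taken fibrewise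
  over \<open>w\<close>.
\<close>

definition X_supp ::
    "(real^'k::finite) set \<Rightarrow> (real^'k \<Rightarrow> (real \<times> (real^'j::finite)) measure) \<Rightarrow> (real \<times> (real^'j) \<times> (real^'k)) set" where
  "X_supp W R = {(d, z, w). w \<in> W \<and> (d, z) \<in> supp (R w)}"

definition ZW_supp ::
    "(real^'k::finite) set \<Rightarrow> (real^'k \<Rightarrow> (real \<times> (real^'j)) measure) \<Rightarrow> ((real^'j) \<times> (real^'k)) set" where
  "ZW_supp W R = {(z, w). w \<in> W \<and> z \<in> supp (distr (R w) borel snd)}"

text \<open>\<open>K\<close> is a regular conditional distribution of \<open>d\<close> given \<open>z\<close> when \<open>(d, z)\<close> has law \<open>Q\<close>.\<close>

definition is_cond_law_d ::
    "(real \<times> (real^'j::finite)) measure \<Rightarrow> ((real^'j) \<Rightarrow> real measure) \<Rightarrow> bool" where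
  "is_cond_law_d Q K \<longleftrightarrow>
     K \<in> borel \<rightarrow>\<^sub>M prob_algebra borel \<and>
     (\<forall>A \<in> sets borel. \<forall>B \<in> sets borel.
        emeasure Q (A \<times> B) = (\<integral>\<^sup>+z. emeasure (K z) A * indicator B z \<partial>distr Q borel snd))"

text \<open>\<open>D_supp K z w\<close> is \<open>D\<^bsub>(z,w)\<^esub>\<close>, the support of \<open>d\<close> conditional on \<open>(z, w)\<close>.\<close>

definition D_supp :: "(real^'k::finite \<Rightarrow> real^'j::finite \<Rightarrow> real measure) \<Rightarrow> real^'j \<Rightarrow> real^'k \<Rightarrow> real set" where
  "D_supp K z w = supp (K w z)"


section \<open>Assumptions\<close>

text \<open>
  The library's \<open>indep_var\<close> needs both variables to have the same codomain type, so independence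
  is stated through the library's \<open>indep_set\<close> for the two preimage sigma-algebras.
\<close>

definition indep_rv ::
    "'o measure \<Rightarrow> ('o \<Rightarrow> 'a::topological_space) \<Rightarrow> ('o \<Rightarrow> 'b::topological_space) \<Rightarrow> bool" where
  "indep_rv M f g \<longleftrightarrow>
     f \<in> M \<rightarrow>\<^sub>M borel \<and> g \<in> M \<rightarrow>\<^sub>M borel \<and>
     prob_space.indep_set M {f -` A \<inter> space M |A. A \<in> sets borel}
                            {g -` B \<inter> space M |B. B \<in> sets borel}"

definition cond_indep :: "('j::finite, 'k::finite) dc_model \<Rightarrow> real^'k \<Rightarrow> bool" where
  "cond_indep S w \<longleftrightarrow>
     indep_rv (law S w) Shock (\<lambda>\<omega>. (Lat \<omega>, DZ \<omega>)) \<and>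
     indep_rv (law S w) Lat DZ"

definition exponential_on :: "real set \<Rightarrow> (real \<Rightarrow> real) \<Rightarrow> bool" where
  "exponential_on U f \<longleftrightarrow> (\<exists>K1 K2 K3. \<forall>d\<in>U. f d = K1 * exp (K3 * d) + K2)"

definition affine_on :: "real set \<Rightarrow> (real \<Rightarrow> real) \<Rightarrow> bool" where
  "affine_on U f \<longleftrightarrow> (\<exists>K1 K2. \<forall>d\<in>U. f d = K1 * d + K2)"

text \<open>
  In the last clause \<open>U\<close> is kept inside the support, since this is where \<open>p0\<close> is known.
\<close>

definition admissible ::
    "(real^'k::finite) set \<Rightarrow> (real^'k \<Rightarrow> (real \<times> (real^'j)) measure) \<Rightarrow> ('j::finite, 'k::finite) dc_model \<Rightarrow> bool"
  where
  "admissible W R S \<longleftrightarrow> (\<forall>w\<in>W.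
     beta1 S w \<noteq> 0 \<and>
     prob_space (law S w) \<and> sets (law S w) = sets borel \<and>
     distr (law S w) borel DZ = R w \<and>
     cond_indep S w \<and>
     distributed (law S w) lborel Lat std_normal_density \<and>
     (\<exists>d z. (d, z) \<in> interior (supp (R w)) \<and> (\<forall>j. z $ j > 0)) \<and>
     (\<exists>d z. (d, z) \<in> interior (supp (R w)) \<and>
        (\<exists>U. open U \<and> (\<forall>d'\<in>U. (d', z) \<in> supp (R w)) \<and>
             \<not> exponential_on U (\<lambda>d'. p0 S (d', z, w)) \<and>
             \<not> affine_on U (\<lambda>d'. p0 S (d', z, w)))))"


section \<open>Identification and bounded completeness\<close>

text \<open>The law \<open>R\<close> of the observed covariates is common to the structures being compared.\<close>

definition identified ::
    "(real^'k::finite) set \<Rightarrow> (real^'k \<Rightarrow> (real \<times> (real^'j)) measure)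
      \<Rightarrow> (('j::finite, 'k::finite) dc_model \<Rightarrow> 'f) \<Rightarrow> bool" where
  "identified W R feature \<longleftrightarrow>
     (\<forall>S S'. admissible W R S \<longrightarrow> admissible W R S' \<longrightarrow>
        (\<forall>x \<in> X_supp W R. p0 S x = p0 S' x) \<longrightarrow> feature S = feature S')"

text \<open>
  ``Almost surely'' means almost surely under every member of the family. The normal location
  family \<open>v_law S (d, z, w)\<close>, \<open>d \<in> D\<close>, is not boundedly complete for every \<open>D\<close> (a single normal
  law never is), and conditions on the joint support of \<open>(d, z)\<close> do not bound the support of
  \<open>d\<close> given one particular \<open>z\<close> from below; completeness is therefore asserted at those \<open>(z, w)\<close>
  for which \<open>D_supp K z w\<close> has a limit point.
\<close>

definition boundedly_complete :: "('i \<Rightarrow> real measure) \<Rightarrow> 'i set \<Rightarrow> bool" where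
  "boundedly_complete F I \<longleftrightarrow>
     (\<forall>g :: real \<Rightarrow> real. g \<in> borel_measurable borel \<longrightarrow> bounded (range g) \<longrightarrow>
        (\<forall>i\<in>I. (\<integral>t. g t \<partial>F i) = 0) \<longrightarrow> (\<forall>i\<in>I. AE t in F i. g t = 0))"


section \<open>\<open>p0\<close> and \<open>v_law\<close> are versions of the conditional quantities\<close>

lemma measurable_outcome [measurable]:
  "DZ \<in> (borel :: 'j::finite outcome measure) \<rightarrow>\<^sub>M borel"
  "Lat \<in> (borel :: 'j::finite outcome measure) \<rightarrow>\<^sub>M borel"
  "Shock \<in> (borel :: 'j::finite outcome measure) \<rightarrow>\<^sub>M borel"
  unfolding DZ_def[abs_def] Lat_def[abs_def] Shock_def[abs_def]
  by (intro borel_measurable_continuous_onI continuous_intros)+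

lemma indep_rv_distr:
  fixes f :: "'o \<Rightarrow> 'a::second_countable_topology" and g :: "'o \<Rightarrow> 'b::second_countable_topology"
  assumes "prob_space M" "indep_rv M f g"
  shows "distr M borel (\<lambda>\<omega>. (f \<omega>, g \<omega>)) = distr M borel f \<Otimes>\<^sub>M distr M borel g"
proof -
  interpret prob_space M by fact
  have f: "f \<in> M \<rightarrow>\<^sub>M borel" and g: "g \<in> M \<rightarrow>\<^sub>M borel"
    and ind: "indep_set {f -` A \<inter> space M |A. A \<in> sets borel} {g -` B \<inter> space M |B. B \<in> sets borel}"
    using assms(2) by (auto simp: indep_rv_def)
  interpret F: prob_space "distr M borel f" by (rule prob_space_distr[OF f])
  interpret G: prob_space "distr M borel g" by (rule prob_space_distr[OF g])
  have fg: "(\<lambda>\<omega>. (f \<omega>, g \<omega>)) \<in> M \<rightarrow>\<^sub>M borel"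
    unfolding borel_prod[symmetric] using f g by measurable
  have "distr M borel f \<Otimes>\<^sub>M distr M borel g = distr M borel (\<lambda>\<omega>. (f \<omega>, g \<omega>))"
  proof (rule pair_measure_eqI)
    show "sets (distr M borel f \<Otimes>\<^sub>M distr M borel g) = sets (distr M borel (\<lambda>\<omega>. (f \<omega>, g \<omega>)))"
      by (simp add: borel_prod[symmetric] cong: sets_pair_measure_cong)
  next
    fix A B assume "A \<in> sets (distr M borel f)" "B \<in> sets (distr M borel g)"
    then have A: "A \<in> sets borel" and B: "B \<in> sets borel" by auto
    have AB: "A \<times> B \<in> sets borel"
      unfolding borel_prod[symmetric] using A B by (rule pair_measureI)
    have "prob ((f -` A \<inter> space M) \<inter> (g -` B \<inter> space M))
        = prob (f -` A \<inter> space M) * prob (g -` B \<inter> space M)"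
      using A B by (intro indep_setD[OF ind]) auto
    moreover have "(\<lambda>\<omega>. (f \<omega>, g \<omega>)) -` (A \<times> B) \<inter> space M
        = (f -` A \<inter> space M) \<inter> (g -` B \<inter> space M)" by auto
    ultimately show "emeasure (distr M borel f) A * emeasure (distr M borel g) B
        = emeasure (distr M borel (\<lambda>\<omega>. (f \<omega>, g \<omega>))) (A \<times> B)"
      using A B AB f g fg
      by (simp add: emeasure_distr emeasure_eq_measure ennreal_mult)
  qed (unfold_locales)
  then show ?thesis by simp
qed

lemma outside_chosen_iff:
  "outside_chosen S w \<omega> \<longleftrightarrow> (\<forall>j. Shock \<omega> $ j \<le>
     - snd (DZ \<omega>) $ j * (beta0 S w + beta1 S w * fst (DZ \<omega>) + Lat \<omega>))"
proof -
  have "outside_chosen S w \<omega> \<longleftrightarrow> (\<forall>j. utility S w \<omega> (Some j) \<le> utility S w \<omega> None)"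
    unfolding outside_chosen_def by (metis option.exhaust order_refl)
  moreover have "utility S w \<omega> (Some j) \<le> utility S w \<omega> None \<longleftrightarrow> Shock \<omega> $ j \<le>
      - snd (DZ \<omega>) $ j * (beta0 S w + beta1 S w * fst (DZ \<omega>) + Lat \<omega>)" for j
    unfolding utility_def option.case mult_minus_left by linarith
  ultimately show ?thesis by simp
qed

lemma measurable_eps_below:
  fixes S :: "('j::finite, 'k::finite) dc_model"
  shows "{(u, e, x). \<forall>j. u $ j \<le> - snd x $ j * (beta0 S w + beta1 S w * fst x + e)}
    \<in> sets (borel :: ((real^'j) \<times> real \<times> real \<times> (real^'j)) measure)"
proof -
  have "{(u :: real^'j, e, x). \<forall>j. u $ j \<le> - snd x $ j * (beta0 S w + beta1 S w * fst x + e)}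
    = (\<Inter>j. {y. fst y $ j \<le>
        - snd (snd (snd y)) $ j * (beta0 S w + beta1 S w * fst (snd (snd y)) + fst (snd y))})"
    by auto
  also have "closed \<dots>"
    by (intro closed_INT ballI closed_Collect_le continuous_intros)
  finally show ?thesis by (rule borel_closed)
qed

lemma p0_conditional_probability:
  fixes S :: "('j::finite, 'k::finite) dc_model"
  assumes M: "prob_space (law S w)" "sets (law S w) = sets borel"
    and ind: "cond_indep S w" and A: "A \<in> sets borel"
  shows "emeasure (law S w) {\<omega>. DZ \<omega> \<in> A \<and> outside_chosen S w \<omega>}
    = (\<integral>\<^sup>+x. ennreal (p0 S (fst x, snd x, w)) * indicator A x \<partial>distr (law S w) borel DZ)"
proof -
  let ?M = "law S w" and ?E = "lat_law S w"
  let ?N = "distr ?M borel Shock" and ?R = "distr ?M borel DZ"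
  let ?B = "{(u :: real^'j, e, x). \<forall>j. u $ j \<le> - snd x $ j * (beta0 S w + beta1 S w * fst x + e)}"
  note [measurable_cong] = M(2)
  interpret prob_space ?M by fact
  have sp: "space ?M = UNIV" using sets_eq_imp_space_eq[OF M(2)] by simp
  interpret N: prob_space ?N by (rule prob_space_distr) measurable
  interpret E: prob_space ?E unfolding lat_law_def by (rule prob_space_distr) measurable
  interpret R: prob_space ?R by (rule prob_space_distr) measurable
  interpret ER: pair_prob_space ?E ?R ..
  interpret NER: pair_prob_space ?N "?E \<Otimes>\<^sub>M ?R" ..
  have [simp]: "sets ?E = sets borel" by (simp add: lat_law_def)
  note [measurable_cong] = \<open>sets ?E = sets borel\<close>
  have law_ER: "distr ?M borel (\<lambda>\<omega>. (Lat \<omega>, DZ \<omega>)) = ?E \<Otimes>\<^sub>M ?R"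
    unfolding lat_law_def
    by (rule indep_rv_distr[OF M(1)]) (use ind in \<open>simp add: cond_indep_def\<close>)
  have law_NER: "distr ?M borel (\<lambda>\<omega>. (Shock \<omega>, Lat \<omega>, DZ \<omega>)) = ?N \<Otimes>\<^sub>M (?E \<Otimes>\<^sub>M ?R)"
    unfolding law_ER[symmetric]
    by (rule indep_rv_distr[OF M(1)]) (use ind in \<open>simp add: cond_indep_def\<close>)
  have sets_ER: "sets (?E \<Otimes>\<^sub>M ?R) = sets borel"
    unfolding law_ER[symmetric] by (rule sets_distr)
  have meas3: "(\<lambda>\<omega>. (Shock \<omega>, Lat \<omega>, DZ \<omega>)) \<in> ?M \<rightarrow>\<^sub>M borel"
    by (intro borel_measurable_Pair) (simp_all add: measurable_cong_sets[OF M(2) refl] measurable_outcome)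
  have sets_NER: "sets (?N \<Otimes>\<^sub>M (?E \<Otimes>\<^sub>M ?R)) = sets borel"
    unfolding law_NER[symmetric] by (rule sets_distr)
  have snd_snd: "(\<lambda>y. snd (snd y)) \<in> (borel :: ((real^'j) \<times> real \<times> real \<times> (real^'j)) measure) \<rightarrow>\<^sub>M borel"
    by (intro borel_measurable_continuous_onI continuous_intros)
  have C: "?B \<inter> (\<lambda>y. snd (snd y)) -` A \<in> sets borel"
    using measurable_sets[OF snd_snd A] measurable_eps_below[of S w] by auto
  have eps: "emeasure ?N {u. \<forall>j. u $ j \<le> a $ j} = ennreal (eps_cdf S w a)" for a
    unfolding eps_cdf_def by (rule N.emeasure_eq_measure)
  have fin: "(\<integral>\<^sup>+e. ennreal (eps_cdf S w (\<chi> j. - snd x $ j * (beta0 S w + beta1 S w * fst x + e))) \<partial>?E)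
     = ennreal (p0 S (fst x, snd x, w))" for x
  proof -
    have Bx: "{(u, e). \<forall>j. u $ j \<le> - snd x $ j * (beta0 S w + beta1 S w * fst x + e)} \<in> sets (borel \<Otimes>\<^sub>M ?E)"
    proof -
      have "{(u, e). \<forall>j. u $ j \<le> - snd x $ j * (beta0 S w + beta1 S w * fst x + e)}
         = (\<Inter>j. {y :: (real^'j) \<times> real. fst y $ j \<le> - snd x $ j * (beta0 S w + beta1 S w * fst x + snd y)})"
        by auto
      also have "closed \<dots>"
        by (intro closed_INT ballI closed_Collect_le continuous_intros)
      finally have "{(u, e). \<forall>j. u $ j \<le> - snd x $ j * (beta0 S w + beta1 S w * fst x + e)}
          \<in> sets (borel :: ((real^'j) \<times> real) measure)" by (rule borel_closed)
      then show ?thesis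
        by (simp add: borel_prod[symmetric] cong: sets_pair_measure_cong)
    qed
    interpret NE: pair_prob_space ?N ?E ..
    have "(\<lambda>e. emeasure ?N ((\<lambda>u. (u, e)) -` {(u, e). \<forall>j. u $ j \<le> - snd x $ j * (beta0 S w + beta1 S w * fst x + e)}))
        \<in> borel_measurable ?E"
      by (rule NE.measurable_emeasure_Pair2) (use Bx in \<open>simp cong: sets_pair_measure_cong\<close>)
    moreover have "(\<lambda>u. (u, e)) -` {(u, e). \<forall>j. u $ j \<le> - snd x $ j * (beta0 S w + beta1 S w * fst x + e)}
      = {u. \<forall>j. u $ j \<le> (\<chi> j. - snd x $ j * (beta0 S w + beta1 S w * fst x + e)) $ j}" for e
      by auto
    ultimately have "(\<lambda>e. ennreal (eps_cdf S w (\<chi> j. - snd x $ j * (beta0 S w + beta1 S w * fst x + e))))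
        \<in> borel_measurable ?E"
      by (simp only: eps)
    then have m: "(\<lambda>e. eps_cdf S w (\<chi> j. - snd x $ j * (beta0 S w + beta1 S w * fst x + e)))
        \<in> borel_measurable ?E"
      by - (drule borel_measurable_enn2real, simp add: eps_cdf_def)
    have "integrable ?E (\<lambda>e. eps_cdf S w (\<chi> j. - snd x $ j * (beta0 S w + beta1 S w * fst x + e)))"
      by (rule E.integrable_const_bound[where B = 1])
         (use m in \<open>auto simp: eps_cdf_def intro!: N.prob_le_1\<close>)
    then show ?thesis
      unfolding p0_def prod.case
      by (intro nn_integral_eq_integral) (auto simp: eps_cdf_def)
  qed
  have "emeasure ?M {\<omega>. DZ \<omega> \<in> A \<and> outside_chosen S w \<omega>}
      = emeasure (distr ?M borel (\<lambda>\<omega>. (Shock \<omega>, Lat \<omega>, DZ \<omega>))) (?B \<inter> (\<lambda>y. snd (snd y)) -` A)"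
    using C meas3
    by (subst emeasure_distr) (auto simp: sp outside_chosen_iff intro!: arg_cong2[where f = emeasure])
  also have "\<dots> = (\<integral>\<^sup>+ex. emeasure ?N ((\<lambda>u. (u, ex)) -` (?B \<inter> (\<lambda>y. snd (snd y)) -` A)) \<partial>(?E \<Otimes>\<^sub>M ?R))"
    unfolding law_NER by (rule NER.emeasure_pair_measure_alt2) (use C sets_NER in simp)
  also have "\<dots> = (\<integral>\<^sup>+x. \<integral>\<^sup>+e. emeasure ?N ((\<lambda>u. (u, (e, x))) -` (?B \<inter> (\<lambda>y. snd (snd y)) -` A)) \<partial>?E \<partial>?R)"
    by (rule ER.nn_integral_snd[symmetric])
       (use NER.measurable_emeasure_Pair2[of "?B \<inter> (\<lambda>y. snd (snd y)) -` A"] C sets_NER in simp)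
  also have "\<dots> = (\<integral>\<^sup>+x. ennreal (p0 S (fst x, snd x, w)) * indicator A x \<partial>?R)"
  proof (rule nn_integral_cong)
    fix x
    have *: "(\<lambda>u. (u, (e, x))) -` (?B \<inter> (\<lambda>y. snd (snd y)) -` A)
      = (if x \<in> A then {u. \<forall>j. u $ j \<le> (\<chi> j. - snd x $ j * (beta0 S w + beta1 S w * fst x + e)) $ j} else {})"
      for e by auto
    show "(\<integral>\<^sup>+e. emeasure ?N ((\<lambda>u. (u, (e, x))) -` (?B \<inter> (\<lambda>y. snd (snd y)) -` A)) \<partial>?E)
        = ennreal (p0 S (fst x, snd x, w)) * indicator A x"
      unfolding * by (cases "x \<in> A") (simp_all only: if_True if_False eps fin, simp_all)
  qed
  finally show ?thesis .
qed

lemma v_law_conditional_law: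
  fixes S :: "('j::finite, 'k::finite) dc_model"
  assumes M: "prob_space (law S w)" "sets (law S w) = sets borel"
    and ind: "cond_indep S w" and A: "A \<in> sets borel" and B: "B \<in> sets borel"
  shows "emeasure (law S w) {\<omega>. DZ \<omega> \<in> A \<and> beta0 S w + beta1 S w * fst (DZ \<omega>) + Lat \<omega> \<in> B}
    = (\<integral>\<^sup>+x. emeasure (v_law S (fst x, snd x, w)) B * indicator A x \<partial>distr (law S w) borel DZ)"
proof -
  let ?M = "law S w" and ?E = "lat_law S w"
  let ?R = "distr ?M borel DZ"
  let ?v = "\<lambda>y :: real \<times> real \<times> (real^'j). beta0 S w + beta1 S w * fst (snd y) + fst y"
  note [measurable_cong] = M(2)
  interpret prob_space ?M by fact
  have sp: "space ?M = UNIV" using sets_eq_imp_space_eq[OF M(2)] by simp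
  interpret E: prob_space ?E unfolding lat_law_def by (rule prob_space_distr) measurable
  interpret R: prob_space ?R by (rule prob_space_distr) measurable
  interpret ER: pair_prob_space ?E ?R ..
  have [simp]: "sets ?E = sets borel" "space ?E = UNIV" by (simp_all add: lat_law_def)
  note [measurable_cong] = \<open>sets ?E = sets borel\<close>
  have law_ER: "distr ?M borel (\<lambda>\<omega>. (Lat \<omega>, DZ \<omega>)) = ?E \<Otimes>\<^sub>M ?R"
    unfolding lat_law_def
    by (rule indep_rv_distr[OF M(1)]) (use ind in \<open>simp add: cond_indep_def\<close>)
  have sets_ER: "sets (?E \<Otimes>\<^sub>M ?R) = sets borel"
    unfolding law_ER[symmetric] by (rule sets_distr)
  have meas2: "(\<lambda>\<omega>. (Lat \<omega>, DZ \<omega>)) \<in> ?M \<rightarrow>\<^sub>M borel"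
    by (intro borel_measurable_Pair) (simp_all add: measurable_cong_sets[OF M(2) refl] measurable_outcome)
  have v: "?v \<in> borel \<rightarrow>\<^sub>M borel" and s: "snd \<in> (borel :: (real \<times> real \<times> (real^'j)) measure) \<rightarrow>\<^sub>M borel"
    by (intro borel_measurable_continuous_onI continuous_intros)+
  have C: "?v -` B \<inter> snd -` A \<in> sets borel"
    using measurable_sets[OF v B] measurable_sets[OF s A] by auto
  have "emeasure ?M {\<omega>. DZ \<omega> \<in> A \<and> beta0 S w + beta1 S w * fst (DZ \<omega>) + Lat \<omega> \<in> B}
      = emeasure (distr ?M borel (\<lambda>\<omega>. (Lat \<omega>, DZ \<omega>))) (?v -` B \<inter> snd -` A)"
    using C meas2
    by (subst emeasure_distr) (auto simp: sp intro!: arg_cong2[where f = emeasure])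
  also have "\<dots> = (\<integral>\<^sup>+x. emeasure ?E ((\<lambda>e. (e, x)) -` (?v -` B \<inter> snd -` A)) \<partial>?R)"
    unfolding law_ER by (rule ER.emeasure_pair_measure_alt2) (use C sets_ER in simp)
  also have "\<dots> = (\<integral>\<^sup>+x. emeasure (v_law S (fst x, snd x, w)) B * indicator A x \<partial>?R)"
  proof (rule nn_integral_cong)
    fix x
    have "emeasure (v_law S (fst x, snd x, w)) B
        = emeasure ?E ((\<lambda>e. beta0 S w + beta1 S w * fst x + e) -` B)"
    proof -
      have "(\<lambda>e. beta0 S w + beta1 S w * fst x + e) \<in> ?E \<rightarrow>\<^sub>M borel" by measurable
      from emeasure_distr[OF this B] show ?thesis by (simp add: v_law_def)
    qed
    moreover have "(\<lambda>e. (e, x)) -` (?v -` B \<inter> snd -` A)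
        = (if x \<in> A then (\<lambda>e. beta0 S w + beta1 S w * fst x + e) -` B else {})" by auto
    ultimately show "emeasure ?E ((\<lambda>e. (e, x)) -` (?v -` B \<inter> snd -` A))
        = emeasure (v_law S (fst x, snd x, w)) B * indicator A x" by simp
  qed
  finally show ?thesis .
qed

end

theory Submission
  imports Defs "HOL-Complex_Analysis.Conformal_Mappings"
begin

text \<open>
  Fix \<open>w\<close> and put \<open>G\<^sub>z(v) = F(-z\<^sub>1 v, \<dots>, -z\<^sub>J v)\<close> and \<open>m = \<beta>\<^sub>0 + \<beta>\<^sub>1 d\<close>. Then \<open>p\<^sub>0(d, z / \<kappa>)\<close> is
  the mean of \<open>G\<^sub>z(v / \<kappa>)\<close> for \<open>v\<close> normal with mean \<open>m\<close> and variance \<open>1\<close>; it extends to an entire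
  function of \<open>d\<close>, and the heat equation gives, at \<open>\<kappa> = 1\<close>,
  \<open>-\<partial>\<^sub>\<kappa> p\<^sub>0 = (\<beta>\<^sub>0 / \<beta>\<^sub>1 + d) \<partial>\<^sub>d p\<^sub>0 + \<beta>\<^sub>1\<^sup>-\<^sup>2 \<partial>\<^sub>d\<^sup>2 p\<^sub>0\<close>.
  Two structures with the same \<open>p\<^sub>0\<close> near a point of the interior of the support therefore yield a
  constant-coefficient linear relation between \<open>\<partial>\<^sub>d p\<^sub>0\<close> and \<open>\<partial>\<^sub>d\<^sup>2 p\<^sub>0\<close>, which extends to the whole
  line by analyticity and forces \<open>p\<^sub>0\<close> to be exponential or affine unless \<open>\<beta>\<^sub>0 / \<beta>\<^sub>1\<close> and \<open>\<beta>\<^sub>1\<^sup>2\<close>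
  agree. The sign of \<open>\<beta>\<^sub>1\<close> is read off at a positive \<open>z\<close>, where \<open>G\<^sub>z\<close> is decreasing from \<open>1\<close> to \<open>0\<close>, so
  that opposite signs would make \<open>p\<^sub>0\<close> locally constant in \<open>d\<close>, contradicting completeness of the
  normal location family. That completeness holds because \<open>m \<mapsto> \<integral> g(t) \<phi>(t - m) dt\<close> is entire: if it
  vanishes on a set with a limit point, it vanishes on the imaginary axis, so the Fourier transform
  of \<open>g \<phi>\<close> is zero.
\<close>

section \<open>Gaussian smoothing of bounded functions\<close>

text \<open>Cauchy's estimate turns the bound on \<open>f\<close> into one on its difference quotients, so no bound on
  the derivative has to be assumed.\<close>

lemma has_field_derivative_integral:
  fixes f :: "complex \<Rightarrow> 'a \<Rightarrow> complex"
  assumes "0 < r"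
    and df: "\<And>z t. z \<in> ball z0 r \<Longrightarrow> ((\<lambda>z. f z t) has_field_derivative f' z t) (at z)"
    and meas: "\<And>z. z \<in> ball z0 r \<Longrightarrow> f z \<in> borel_measurable M" "f' z0 \<in> borel_measurable M"
    and B: "integrable M B" "\<And>z t. z \<in> ball z0 r \<Longrightarrow> norm (f z t) \<le> B t"
  shows "((\<lambda>z. \<integral>t. f z t \<partial>M) has_field_derivative (\<integral>t. f' z0 t \<partial>M)) (at z0)"
proof -
  have hol: "(\<lambda>z. f z t) holomorphic_on ball z0 r" for t
    using df by (meson holomorphic_onI field_differentiable_at_within field_differentiable_def)
  have f'_le: "norm (f' z t) \<le> B t / (r / 4)" if z: "z \<in> ball z0 (r / 2)" for z t
  proof -
    \<comment> \<open>With \<open>z\<close> within \<open>r / 2\<close> of \<open>z0\<close>, a disc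
      of radius \<open>r / 4\<close> about \<open>z\<close> stays inside \<open>ball z0 r\<close>,
      where \<open>B\<close> bounds \<open>f\<close>.\<close>
    have sub: "cball z (r / 4) \<subseteq> ball z0 r"
    proof
      fix y assume "y \<in> cball z (r / 4)"
      then have "dist z0 y < r / 2 + r / 4"
        using z by (metis add_less_le_mono dist_triangle_less_add mem_ball mem_cball dist_triangle order_le_less_trans)
      then show "y \<in> ball z0 r" using \<open>0 < r\<close> by simp
    qed
    have "norm ((deriv ^^ 1) (\<lambda>z. f z t) z) \<le> fact 1 * B t / (r / 4) ^ 1"
    proof (rule Cauchy_inequality)
      show "(\<lambda>z. f z t) holomorphic_on ball z (r / 4)"
        by (rule holomorphic_on_subset[OF hol]) (use sub in auto)
      show "continuous_on (cball z (r / 4)) (\<lambda>z. f z t)"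
        by (rule continuous_on_subset[OF holomorphic_on_imp_continuous_on[OF hol] sub])
      fix x assume "cmod (z - x) = r / 4"
      then have "x \<in> cball z (r / 4)" by (simp add: dist_norm)
      then show "cmod (f x t) \<le> B t" using sub B(2) by blast
    qed (use \<open>0 < r\<close> in simp)
    moreover have "z \<in> ball z0 r" using z \<open>0 < r\<close> by auto
    ultimately show ?thesis using DERIV_imp_deriv[OF df] by simp
  qed
  have int: "integrable M (f z)" if "z \<in> ball z0 r" for z
    by (rule Bochner_Integration.integrable_bound[OF B(1) meas(1)[OF that]])
      (use order_trans[OF B(2)[OF that] abs_ge_self] in auto)
  have z0: "z0 \<in> ball z0 r" using \<open>0 < r\<close> by simp
  \<comment> \<open>Dominated convergence concerns sequences, so the limit is tested along sequences
    in \<open>ball z0 (r / 2)\<close>, where the bound on \<open>f'\<close> controls every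
    difference quotient.\<close>
  have "((\<lambda>z. ((\<integral>t. f z t \<partial>M) - (\<integral>t. f z0 t \<partial>M)) / (z - z0)) \<longlongrightarrow> (\<integral>t. f' z0 t \<partial>M)) (at z0 within ball z0 (r / 2))"
    unfolding tendsto_at_iff_sequentially comp_def
  proof (intro allI impI)
    fix X :: "nat \<Rightarrow> complex" assume X: "\<forall>i. X i \<in> ball z0 (r / 2) - {z0}" and lim: "X \<longlonglongrightarrow> z0"
    have Xr: "X i \<in> ball z0 r" for i using X[rule_format, of i] \<open>0 < r\<close> by auto
    have eq: "((\<integral>t. f (X i) t \<partial>M) - (\<integral>t. f z0 t \<partial>M)) / (X i - z0)
        = (\<integral>t. (f (X i) t - f z0 t) / (X i - z0) \<partial>M)" for i
      using int[OF Xr] int[OF z0] by simp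
    show "(\<lambda>i. ((\<integral>t. f (X i) t \<partial>M) - (\<integral>t. f z0 t \<partial>M)) / (X i - z0)) \<longlonglongrightarrow> (\<integral>t. f' z0 t \<partial>M)"
      unfolding eq
    proof (rule integral_dominated_convergence[where w = "\<lambda>t. B t / (r / 4)"])
      show "(\<lambda>t. (f (X i) t - f z0 t) / (X i - z0)) \<in> borel_measurable M" for i
        using meas(1)[OF Xr] meas(1)[OF z0] by simp
      show "AE t in M. (\<lambda>i. (f (X i) t - f z0 t) / (X i - z0)) \<longlonglongrightarrow> f' z0 t"
        using df[OF z0] X lim
        by (auto simp: has_field_derivative_iff tendsto_at_iff_sequentially comp_def)
      show "AE t in M. norm ((f (X i) t - f z0 t) / (X i - z0)) \<le> B t / (r / 4)" for i
      proof (rule AE_I2)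
        fix t
        have "norm (f (X i) t - f z0 t) \<le> B t / (r / 4) * norm (X i - z0)"
        proof (rule field_differentiable_bound[of "ball z0 (r / 2)"])
          show "((\<lambda>z. f z t) has_field_derivative f' z t) (at z within ball z0 (r / 2))"
            if "z \<in> ball z0 (r / 2)" for z
            by (rule has_field_derivative_at_within, rule df) (use that \<open>0 < r\<close> in auto)
        qed (use f'_le X \<open>0 < r\<close> in auto)
        then show "norm ((f (X i) t - f z0 t) / (X i - z0)) \<le> B t / (r / 4)"
          using X by (simp add: norm_divide divide_le_eq)
      qed
    qed (use meas(2) B(1) in auto)
  qed
  then show ?thesis
    using \<open>0 < r\<close> by (simp add: has_field_derivative_iff at_within_open[OF _ open_ball])
qed

text \<open>For real \<open>m\<close> and real \<kappa> > 0 this is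
  \<open>sqrt (2 * pi) / \<kappa>\<close> times the mean of \<open>g u * u ^ n\<close> at
  \<open>u = V / \<kappa>\<close>, where \<open>V\<close> is normal with mean \<open>m\<close> and
  variance 1. A square in place of a squared modulus keeps the integrand analytic in \<kappa> and
  \<open>m\<close>.\<close>

definition gauss_moment :: "(real \<Rightarrow> real) \<Rightarrow> nat \<Rightarrow> complex \<Rightarrow> complex \<Rightarrow> complex" where
  "gauss_moment g n \<kappa> m =
     (\<integral>u. of_real (g u * u ^ n) * exp (- (\<kappa> * of_real u - m)\<^sup>2 / 2) \<partial>lborel)"

text \<open>A multiple of the normal density with standard deviation 2. It dominates the integrands
  in all later differentiations under the integral.\<close>

lemma integrable_exp_minus_square: "integrable lborel (\<lambda>u :: real. C * exp (- u\<^sup>2 / 8))"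
proof -
  have "integrable lborel (\<lambda>u. (C * sqrt (2 * pi * 2\<^sup>2)) * normal_density 0 2 u)"
    by (intro integrable_mult_right integrable_normal_density)
      simp
  moreover have "(\<lambda>u. (C * sqrt (2 * pi * 2\<^sup>2)) * normal_density 0 2 u) = (\<lambda>u. C * exp (- u\<^sup>2 / 8))"
    by (simp add: normal_density_def fun_eq_iff)
  ultimately show ?thesis by argo
qed

text \<open>For \<kappa> within 1/4 of 1 the real part of \<open>\<kappa>\<^sup>2\<close> is at
  least 9/16 - 1/16 = 1/2, so the exponent is at most \<open>- u\<^sup>2 / 4\<close> plus terms of
  lower order in \<open>u\<close>. Half of the quadratic term absorbs these, uniformly in \<kappa>
  and in \<open>m\<close> with modulus at most \<open>b\<close>.\<close>

lemma gauss_moment_integrand_bound: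
  assumes g: "\<And>u. \<bar>g u\<bar> \<le> C" and \<kappa>: "\<kappa> \<in> ball 1 (1 / 4)" and m: "cmod m \<le> b"
  shows "cmod (of_real (g u * u ^ n) * exp (- (\<kappa> * of_real u - m)\<^sup>2 / 2))
    \<le> C * exp (b\<^sup>2 / 2 + 2 * (n + 2 * b)\<^sup>2) * exp (- u\<^sup>2 / 8)"
proof -
  have C: "0 \<le> C" using g[of 0] by linarith
  have \<kappa>': "cmod (\<kappa> - 1) < 1 / 4" using \<kappa> by (simp add: dist_norm norm_minus_commute)
  have "\<bar>Re \<kappa> - 1\<bar> < 1 / 4" "\<bar>Im \<kappa>\<bar> < 1 / 4"
    using abs_Re_le_cmod[of "\<kappa> - 1"] abs_Im_le_cmod[of "\<kappa> - 1"] \<kappa>' by simp_all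
  then have "(3 / 4)\<^sup>2 \<le> (Re \<kappa>)\<^sup>2" "(Im \<kappa>)\<^sup>2 \<le> (1 / 4)\<^sup>2"
    by (auto intro!: power_mono simp: abs_le_square_iff[symmetric] abs_if split: if_splits)
  then have Re\<kappa>2: "1 / 2 \<le> Re (\<kappa>\<^sup>2)" by (simp add: Re_power2 power2_eq_square)
  have "cmod \<kappa> \<le> 2" using norm_triangle_ineq[of "\<kappa> - 1" 1] \<kappa>' by simp
  then have "cmod (\<kappa> * m) \<le> 2 * b" unfolding norm_mult using m by (intro mult_mono) auto
  then have "\<bar>Re (\<kappa> * m)\<bar> \<le> 2 * b" using abs_Re_le_cmod order_trans by blast
  then have "\<bar>u\<bar> * \<bar>Re (\<kappa> * m)\<bar> \<le> \<bar>u\<bar> * (2 * b)" by (intro mult_left_mono) auto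
  then have 1: "u * Re (\<kappa> * m) \<le> \<bar>u\<bar> * (2 * b)" by (metis abs_ge_self abs_mult order_trans)
  have "\<bar>Re (m\<^sup>2)\<bar> \<le> b\<^sup>2"
    by (rule order_trans[OF abs_Re_le_cmod]) (use m in \<open>simp add: norm_power power_mono\<close>)
  moreover have "1 / 2 * u\<^sup>2 \<le> Re (\<kappa>\<^sup>2) * u\<^sup>2" using Re\<kappa>2 by (intro mult_right_mono) auto
  moreover have "Re (- (\<kappa> * of_real u - m)\<^sup>2 / 2) = - (Re (\<kappa>\<^sup>2) * u\<^sup>2) / 2 + u * Re (\<kappa> * m) - Re (m\<^sup>2) / 2"
    by (simp add: power2_eq_square field_simps)
  ultimately have 2: "Re (- (\<kappa> * of_real u - m)\<^sup>2 / 2) \<le> - u\<^sup>2 / 4 + \<bar>u\<bar> * (2 * b) + b\<^sup>2 / 2"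
    using 1 by linarith
  \<comment> \<open>The polynomial factor is turned into a linear term of the exponent.\<close>
  have "\<bar>u\<bar> ^ n \<le> exp \<bar>u\<bar> ^ n"
    by (intro power_mono) (use exp_ge_add_one_self[of "\<bar>u\<bar>"] in linarith, simp)
  also have "\<dots> = exp (n * \<bar>u\<bar>)" by (simp add: exp_of_nat_mult)
  finally have "\<bar>g u\<bar> * \<bar>u\<bar> ^ n \<le> C * exp (n * \<bar>u\<bar>)"
    using g by (intro mult_mono) (auto intro: order_trans[OF abs_ge_zero])
  then have "cmod (of_real (g u * u ^ n) * exp (- (\<kappa> * of_real u - m)\<^sup>2 / 2))
      \<le> C * exp (n * \<bar>u\<bar>) * exp (- u\<^sup>2 / 4 + \<bar>u\<bar> * (2 * b) + b\<^sup>2 / 2)"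
    unfolding norm_mult norm_exp_eq_Re using 2
    using C by (intro mult_mono) (auto simp: norm_mult norm_power)
  also have "\<dots> = C * exp (n * \<bar>u\<bar> + (- u\<^sup>2 / 4 + \<bar>u\<bar> * (2 * b) + b\<^sup>2 / 2))"
    by (simp add: exp_add)
  also have "\<dots> \<le> C * exp (b\<^sup>2 / 2 + 2 * (n + 2 * b)\<^sup>2 + - u\<^sup>2 / 8)"
  proof -
    \<comment> \<open>Completing the square:
      \<open>a * \<bar>u\<bar> \<le> u\<^sup>2 / 8 + 2 * a\<^sup>2\<close> with
      \<open>a = n + 2 * b\<close>.\<close>
    have "0 \<le> (\<bar>u\<bar> / 4 - (n + 2 * b))\<^sup>2" by simp
    then have "n * \<bar>u\<bar> + (- u\<^sup>2 / 4 + \<bar>u\<bar> * (2 * b) + b\<^sup>2 / 2) \<le> b\<^sup>2 / 2 + 2 * (n + 2 * b)\<^sup>2 + - u\<^sup>2 / 8"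
      by (simp add: power2_diff power_divide algebra_simps)
    then show ?thesis using C by (intro mult_left_mono) auto
  qed
  finally show ?thesis unfolding exp_add by (simp add: mult.assoc)
qed

text \<open>Differentiation of the kernel brings down \<open>\<kappa> * u - m\<close> for the mean
  and \<open>- u * (\<kappa> * u - m)\<close> for the scale, which raises the order of the moment by
  one or two.\<close>

lemma gauss_moment_has_derivs:
  assumes [measurable]: "g \<in> borel_measurable borel" and g: "\<And>u. \<bar>g u\<bar> \<le> C"
  shows gauss_moment_deriv_mean: "\<kappa> \<in> ball 1 (1 / 4) \<Longrightarrow> (gauss_moment g n \<kappa> has_field_derivative
      \<kappa> * gauss_moment g (Suc n) \<kappa> m - m * gauss_moment g n \<kappa> m) (at m)"
    and gauss_moment_deriv_scale: "((\<lambda>\<kappa>. gauss_moment g n \<kappa> m) has_field_derivative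
      m * gauss_moment g (Suc n) 1 m - gauss_moment g (Suc (Suc n)) 1 m) (at 1)"
proof -
  define k where "k n \<kappa> m u = complex_of_real (g u * u ^ n) * exp (- (\<kappa> * of_real u - m)\<^sup>2 / 2)" for n \<kappa> m u
  have gm: "gauss_moment g n \<kappa> m = (\<integral>u. k n \<kappa> m u \<partial>lborel)" for n \<kappa> m
    by (simp add: gauss_moment_def k_def)
  have [measurable]: "k n \<kappa> m \<in> borel_measurable lborel" for n \<kappa> m
    unfolding k_def by measurable
  have bound: "cmod (k n \<kappa> m u) \<le> C * exp (b\<^sup>2 / 2 + 2 * (n + 2 * b)\<^sup>2) * exp (- u\<^sup>2 / 8)"
    if "\<kappa> \<in> ball 1 (1 / 4)" "cmod m \<le> b" for n \<kappa> m u b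
    using gauss_moment_integrand_bound[OF g that] by (simp add: k_def)
  have int: "integrable lborel (k n \<kappa> m)" if "\<kappa> \<in> ball 1 (1 / 4)" for n \<kappa> m
    by (rule Bochner_Integration.integrable_bound[OF integrable_exp_minus_square
          [of "C * exp ((cmod m)\<^sup>2 / 2 + 2 * (n + 2 * cmod m)\<^sup>2)"]])
      (use order_trans[OF bound[OF that order_refl] abs_ge_self] in auto)
  {
    assume \<kappa>: "\<kappa> \<in> ball 1 (1 / 4)"
    have "((\<lambda>m. \<integral>u. k n \<kappa> m u \<partial>lborel) has_field_derivative
        (\<integral>u. \<kappa> * k (Suc n) \<kappa> m u - m * k n \<kappa> m u \<partial>lborel)) (at m)"
    proof (rule has_field_derivative_integral)
      show "((\<lambda>m. k n \<kappa> m u) has_field_derivative \<kappa> * k (Suc n) \<kappa> z u - z * k n \<kappa> z u) (at z)" for z u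
        unfolding k_def by (auto intro!: derivative_eq_intros simp: field_simps)
      fix z u assume "z \<in> ball m 1"
      then have "cmod z \<le> cmod m + 1"
        using norm_triangle_ineq[of m "z - m"] by (simp add: dist_norm norm_minus_commute)
      from bound[OF \<kappa> this]
      show "cmod (k n \<kappa> z u) \<le> C * exp ((cmod m + 1)\<^sup>2 / 2 + 2 * (n + 2 * (cmod m + 1))\<^sup>2) * exp (- u\<^sup>2 / 8)" .
    qed (use integrable_exp_minus_square in auto)
    then show "(gauss_moment g n \<kappa> has_field_derivative
      \<kappa> * gauss_moment g (Suc n) \<kappa> m - m * gauss_moment g n \<kappa> m) (at m)"
      using int[OF \<kappa>] by (simp add: gm[abs_def])
  }
  have "((\<lambda>\<kappa>. \<integral>u. k n \<kappa> m u \<partial>lborel) has_field_derivative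
      (\<integral>u. m * k (Suc n) 1 m u - 1 * k (Suc (Suc n)) 1 m u \<partial>lborel)) (at 1)"
  proof (rule has_field_derivative_integral[where r = "1/4"])
    show "((\<lambda>\<kappa>. k n \<kappa> m u) has_field_derivative m * k (Suc n) z m u - z * k (Suc (Suc n)) z m u) (at z)" for z u
      unfolding k_def by (auto intro!: derivative_eq_intros simp: field_simps)
    show "cmod (k n z m u) \<le> C * exp ((cmod m)\<^sup>2 / 2 + 2 * (n + 2 * cmod m)\<^sup>2) * exp (- u\<^sup>2 / 8)"
      if "z \<in> ball 1 (1 / 4)" for z u
      by (rule bound[OF that order_refl])
  qed (use integrable_exp_minus_square in auto)
  then show "((\<lambda>\<kappa>. gauss_moment g n \<kappa> m) has_field_derivative
      m * gauss_moment g (Suc n) 1 m - gauss_moment g (Suc (Suc n)) 1 m) (at 1)"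
    using int by (simp add: gm)
qed


section \<open>Completeness of the normal location family\<close>

lemma integrable_bounded_times_normal_density:
  assumes [measurable]: "g \<in> borel_measurable borel" and g: "\<And>u. \<bar>g u\<bar> \<le> C" and "0 < \<sigma>"
  shows "integrable lborel (\<lambda>u. g u * normal_density \<mu> \<sigma> u)"
proof (rule Bochner_Integration.integrable_bound[where f = "\<lambda>u. C * normal_density \<mu> \<sigma> u"])
  have "C \<ge> 0" using g[of 0] by linarith
  then show "AE u in lborel. norm (g u * normal_density \<mu> \<sigma> u) \<le> norm (C * normal_density \<mu> \<sigma> u)"
    using g by (auto simp: abs_mult intro!: mult_right_mono)
qed (use \<open>0 < \<sigma>\<close> in auto)

lemma gauss_moment_of_real:
  "gauss_moment g 0 (of_real \<kappa>) (of_real m) = of_real (\<integral>u. g u * exp (- (\<kappa> * u - m)\<^sup>2 / 2) \<partial>lborel)"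
  unfolding gauss_moment_def integral_complex_of_real[symmetric]
  by (simp flip: exp_of_real)

lemma gauss_moment_1_of_real:
  "gauss_moment g 0 1 (of_real m) = of_real (sqrt (2 * pi) * (\<integral>u. g u * normal_density m 1 u \<partial>lborel))"
  using gauss_moment_of_real[of g 1 m] by (simp add: normal_density_def)

lemma gauss_moment_holomorphic:
  assumes "g \<in> borel_measurable borel" "\<And>u. \<bar>g u\<bar> \<le> C"
  shows "gauss_moment g n 1 holomorphic_on UNIV"
  unfolding holomorphic_on_def field_differentiable_def
  using gauss_moment_deriv_mean[OF assms, of 1] by auto

text \<open>A limit point on the real line is also one in the plane, so the identity theorem
  applies.\<close>

lemma entire_eq_0_if_zeros_on_reals:
  fixes I :: "real set"
  assumes f: "f holomorphic_on UNIV" and I: "\<xi> islimpt I" and 0: "\<And>x. x \<in> I \<Longrightarrow> f (of_real x) = 0"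
  shows "f w = 0"
proof (rule analytic_continuation[OF f])
  show "complex_of_real \<xi> islimpt of_real ` I"
    unfolding islimpt_approachable
  proof (intro allI impI)
    fix e :: real assume "0 < e"
    then obtain x where "x \<in> I" "x \<noteq> \<xi>" "dist x \<xi> < e"
      using I unfolding islimpt_approachable by blast
    then show "\<exists>y\<in>of_real ` I. y \<noteq> of_real \<xi> \<and> dist y (of_real \<xi> :: complex) < e"
      by (intro bexI[of _ "of_real x"]) auto
  qed
qed (use 0 in auto)

text \<open>The vanishing Fourier transform of \<open>g\<close> times the normal density is
  exploited through uniqueness of characteristic functions. That theorem needs probability measures,
  so the density is perturbed by a small multiple of this product, and perturbed and unperturbed
  laws have the same characteristic function.\<close>

lemma normal_location_family_complete:
  assumes [measurable]: "g \<in> borel_measurable borel" and g: "\<And>u. \<bar>g u\<bar> \<le> C"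
    and I: "\<xi> islimpt I"
    and 0: "\<And>m. m \<in> I \<Longrightarrow> (\<integral>u. g u * normal_density m 1 u \<partial>lborel) = 0"
  shows "AE u in lborel. g u = 0"
proof -
  \<comment> \<open>The added 1 makes the bound strictly positive, so that division by it is
    legitimate even for \<open>C = 0\<close>, and \<open>h\<close> is nonnegative.\<close>
  define C' where "C' = C + 1"
  have C': "C' > 0" "\<bar>g u\<bar> \<le> C'" for u using g[of u] by (auto simp: C'_def)
  define h where "h u = (1 + g u / C') * std_normal_density u" for u
  have h_nonneg: "0 \<le> h u" for u
  proof -
    have "\<bar>g u\<bar> / C' \<le> 1" using C' by simp
    then have "\<bar>g u / C'\<bar> \<le> 1" using C'(1) by (simp add: abs_divide)
    then have "0 \<le> 1 + g u / C'" by linarith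
    then show ?thesis unfolding h_def by (rule mult_nonneg_nonneg) simp
  qed
  have [measurable]: "h \<in> borel_measurable borel" unfolding h_def by measurable
  have gm0: "gauss_moment g 0 1 w = 0" for w
    by (rule entire_eq_0_if_zeros_on_reals[OF gauss_moment_holomorphic[OF assms(1,2)] I])
      (simp add: gauss_moment_1_of_real 0)
  have int_g: "integrable lborel (\<lambda>u. g u * std_normal_density u)"
    by (rule integrable_bounded_times_normal_density[OF assms(1,2)]) simp
  have fourier: "(\<integral>u. of_real (g u * std_normal_density u) * iexp (\<tau> * u) \<partial>lborel) = 0" for \<tau>
  proof -
    have "of_real (g u * std_normal_density u) * iexp (\<tau> * u)
      = of_real (1 / sqrt (2 * pi)) * exp (- (of_real \<tau>)\<^sup>2 / 2) *
        (of_real (g u * u ^ 0) * exp (- (1 * of_real u - \<i> * of_real \<tau>)\<^sup>2 / 2))" for u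
    proof -
      \<comment> \<open>Completing the square in the exponent: the Fourier kernel is the normal
        kernel with the imaginary mean \<open>\<i> * \<tau>\<close>, up to a factor free of
        \<open>u\<close>.\<close>
      have "of_real (exp (- u\<^sup>2 / 2)) * iexp (\<tau> * u)
        = exp (- (of_real \<tau>)\<^sup>2 / 2) * exp (- (1 * of_real u - \<i> * of_real \<tau>)\<^sup>2 / 2)"
        unfolding exp_of_real[symmetric] exp_add[symmetric]
        by (rule arg_cong[where f = exp]) (simp add: power2_eq_square field_simps)
      then show ?thesis
        by (simp add: std_normal_density_def)
    qed
    then have "(\<integral>u. of_real (g u * std_normal_density u) * iexp (\<tau> * u) \<partial>lborel)
      = of_real (1 / sqrt (2 * pi)) * exp (- (of_real \<tau>)\<^sup>2 / 2) * gauss_moment g 0 1 (\<i> * of_real \<tau>)"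
      unfolding gauss_moment_def by (simp only: integral_mult_right_zero)
    then show ?thesis by (simp add: gm0)
  qed
  \<comment> \<open>Frequency 0 shows that the perturbation has total mass zero, so \<open>h\<close>
    is a probability density.\<close>
  have "(\<integral>u. of_real (g u * std_normal_density u) \<partial>lborel) = complex_of_real 0"
    using fourier[of 0] by simp
  then have int_g0: "(\<integral>u. g u * std_normal_density u \<partial>lborel) = 0"
    unfolding integral_complex_of_real of_real_eq_iff .
  have h_eq: "h u = std_normal_density u + g u * std_normal_density u / C'" for u
    by (simp add: h_def algebra_simps)
  have int_h: "integrable lborel h"
    unfolding h_eq[abs_def] using int_g by (intro Bochner_Integration.integrable_add) auto
  have "(\<integral>u. h u \<partial>lborel) = 1"
    unfolding h_eq using int_g int_g0 by simp
  then have "emeasure (density lborel h) UNIV = 1"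
    using h_nonneg int_h by (simp add: emeasure_density nn_integral_eq_integral)
  then have h: "real_distribution (density lborel h)"
    by (intro real_distribution.intro prob_spaceI real_distribution_axioms.intro) auto
  have \<phi>: "real_distribution (density lborel std_normal_density)"
    by (intro real_distribution.intro prob_space_normal_density real_distribution_axioms.intro) auto
  have "char (density lborel h) = char (density lborel std_normal_density)"
  proof
    fix \<tau>
    have int1: "integrable lborel (\<lambda>u. of_real (std_normal_density u) * iexp (\<tau> * u))"
      by (rule Bochner_Integration.integrable_bound[OF integrable_normal_density[of 1 0]])
        (auto simp: norm_mult)
    have int2: "integrable lborel (\<lambda>u. of_real (g u * std_normal_density u) * iexp (\<tau> * u))"
      by (rule Bochner_Integration.integrable_bound[OF int_g]) (auto simp: norm_mult)
    have "char (density lborel h) \<tau> = (\<integral>u. h u *\<^sub>R iexp (\<tau> * u) \<partial>lborel)"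
      unfolding char_def using h_nonneg by (intro integral_density) auto
    also have "\<dots> = (\<integral>u. of_real (std_normal_density u) * iexp (\<tau> * u)
        + of_real (g u * std_normal_density u) * iexp (\<tau> * u) / of_real C' \<partial>lborel)"
      by (rule Bochner_Integration.integral_cong) (simp_all add: h_eq scaleR_conv_of_real algebra_simps)
    also have "\<dots> = (\<integral>u. of_real (std_normal_density u) * iexp (\<tau> * u) \<partial>lborel)
        + (\<integral>u. of_real (g u * std_normal_density u) * iexp (\<tau> * u) \<partial>lborel) / of_real C'"
      using int1 int2 by (subst Bochner_Integration.integral_add) auto
    also have "\<dots> = (\<integral>u. std_normal_density u *\<^sub>R iexp (\<tau> * u) \<partial>lborel)"
      unfolding fourier by (simp add: scaleR_conv_of_real)
    also have "\<dots> = char (density lborel std_normal_density) \<tau>"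
      unfolding char_def by (intro integral_density[symmetric]) auto
    finally show "char (density lborel h) \<tau> = char (density lborel std_normal_density) \<tau>" .
  qed
  then have "density lborel h = density lborel std_normal_density"
    using Levy_uniqueness h \<phi> by blast
  then have "AE u in lborel. ennreal (h u) = ennreal (std_normal_density u)"
    by (intro sigma_finite_measure.density_unique[OF lborel.sigma_finite_measure_axioms]) auto
  then show ?thesis
  proof eventually_elim
    case (elim u)
    then have "h u = std_normal_density u" using h_nonneg by simp
    then show ?case
      using normal_density_pos[of 1 0 u] C'(1) by (simp add: h_def)
  qed
qed

lemma islimpt_affine_image:
  fixes x a b :: real
  assumes "x islimpt I" "b \<noteq> 0"
  shows "(a + b * x) islimpt (\<lambda>x. a + b * x) ` I"
  unfolding islimpt_approachable
proof (intro allI impI)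
  fix e :: real assume "0 < e"
  then have "0 < e / \<bar>b\<bar>" using assms(2) by simp
  then obtain y where y: "y \<in> I" "y \<noteq> x" "dist y x < e / \<bar>b\<bar>"
    using assms(1) unfolding islimpt_approachable by blast
  have "dist (a + b * y) (a + b * x) = \<bar>b\<bar> * dist y x"
    by (simp add: dist_real_def abs_mult[symmetric] right_diff_distrib)
  also have "\<dots> < e" using y(3) assms(2) by (simp add: pos_less_divide_eq mult.commute)
  finally show "\<exists>x'\<in>(\<lambda>x. a + b * x) ` I. x' \<noteq> a + b * x \<and> dist x' (a + b * x) < e"
    using y assms(2) by (intro bexI[of _ "a + b * y"]) auto
qed


section \<open>The heat equation and location-scale identification\<close>

text \<open>If \<open>B = 0\<close>, then \<open>p\<close> is constant. Otherwise \<open>p1\<close>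
  is a multiple of \<open>exp (k * x)\<close> with \<open>k = - A / B\<close>, and integrating once
  more gives an affine function for \<open>k = 0\<close> and an exponential one for other
  \<open>k\<close>.\<close>

lemma exponential_or_affine_if_ode:
  fixes p p1 p2 :: "real \<Rightarrow> real"
  assumes p: "\<And>x. (p has_real_derivative p1 x) (at x)"
    and p1: "\<And>x. (p1 has_real_derivative p2 x) (at x)"
    and ode: "\<And>x. A * p1 x + B * p2 x = 0" and AB: "A \<noteq> 0 \<or> B \<noteq> 0"
  shows "exponential_on U p \<or> affine_on U p"
proof (cases "B = 0")
  case True
  then have "p1 x = 0" for x using ode[of x] AB by simp
  then have "p x = p 0" for x using DERIV_isconst_all[of p x 0] p by simp
  then have "affine_on U p" unfolding affine_on_def by (metis add_0 mult_zero_left)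
  then show ?thesis ..
next
  case False
  define k where "k = - A / B"
  have p2: "p2 x = k * p1 x" for x using ode[of x] False by (simp add: k_def field_simps)
  \<comment> \<open>\<open>exp (- k * x)\<close> is the integrating factor of the first-order
    equation for \<open>p1\<close>.\<close>
  have "((\<lambda>x. p1 x * exp (- k * x)) has_real_derivative 0) (at x)" for x
    by (rule derivative_eq_intros p1 refl | simp add: p2)+
  then have "p1 x * exp (- k * x) = p1 0" for x
    using DERIV_isconst_all[of "\<lambda>x. p1 x * exp (- k * x)" x 0] by simp
  then have p1_eq: "p1 x = p1 0 * exp (k * x)" for x
    by (metis exp_minus_inverse mult.assoc mult.commute mult_1 mult_minus_left)
  show ?thesis
  proof (cases "k = 0")
    case True
    have "((\<lambda>x. p x - p1 0 * x) has_real_derivative 0) (at x)" for x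
      using p1_eq[of x] True by (auto intro!: derivative_eq_intros p)
    from DERIV_isconst_all[OF allI, OF this, of _ 0]
    have "p x = p1 0 * x + p 0" for x by (metis diff_add_cancel diff_zero mult_zero_right add.commute)
    then show ?thesis unfolding affine_on_def by blast
  next
    case False
    have "((\<lambda>x. p x - p1 0 / k * exp (k * x)) has_real_derivative 0) (at x)" for x
      using p1_eq[of x] False by (auto intro!: derivative_eq_intros p)
    from DERIV_isconst_all[OF allI, OF this, of _ 0]
    have "p x = p1 0 / k * exp (k * x) + (p 0 - p1 0 / k * exp (k * 0))" for x
      by (metis diff_add_cancel add.commute)
    then show ?thesis unfolding exponential_on_def by blast
  qed
qed

lemma exponential_on_cmult: "exponential_on U f \<Longrightarrow> exponential_on U (\<lambda>x. c * f x)"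
  unfolding exponential_on_def by (metis distrib_left mult.assoc)

lemma affine_on_cmult: "affine_on U f \<Longrightarrow> affine_on U (\<lambda>x. c * f x)"
  unfolding affine_on_def by (metis distrib_left mult.assoc)

section \<open>Passing between complex and real derivatives\<close>

lemma has_real_derivative_Re_of_real:
  assumes "(f has_field_derivative D) (at (of_real x))"
  shows "((\<lambda>x. Re (f (of_real x))) has_real_derivative Re D) (at x)"
  unfolding has_real_derivative_iff_has_vector_derivative
  by (rule bounded_linear.has_vector_derivative[OF bounded_linear_Re has_vector_derivative_real_field[OF assms]])

text \<open>A complex derivative at a real point is already determined by difference quotients along
  the real axis. This serves for the scale, as outcome probabilities are compared only at real
  \<kappa>.\<close>

lemma has_field_derivative_eq_if_eq_on_reals:
  assumes f: "(f has_field_derivative D) (at (complex_of_real x))"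
    and g: "(g has_field_derivative E) (at (complex_of_real x))"
    and "0 < \<epsilon>" and eq: "\<And>y :: real. \<bar>y - x\<bar> < \<epsilon> \<Longrightarrow> f (of_real y) = g (of_real y)"
  shows "D = E"
proof (rule vector_derivative_unique_at)
  have "((\<lambda>y. f (of_real y)) has_vector_derivative D) (at x)"
    by (rule has_vector_derivative_real_field[OF f])
  then show "((\<lambda>y. g (of_real y)) has_vector_derivative D) (at x)"
    by (rule has_vector_derivative_transform_within_open[of _ _ _ "ball x \<epsilon>"])
      (use \<open>0 < \<epsilon>\<close> eq in \<open>auto simp: dist_real_def abs_minus_commute\<close>)
  show "((\<lambda>y. g (of_real y)) has_vector_derivative E) (at x)"
    by (rule has_vector_derivative_real_field[OF g])
qed

lemma islimpt_ball_real: "0 < \<epsilon> \<Longrightarrow> x islimpt ball (x :: real) \<epsilon>"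
  by (simp add: interior_limit_point)

text \<open>The first derivative of \<open>gauss_moment g 0 1\<close>: the kernel is weighted by
  \<open>u - m\<close>.\<close>

definition dmean_smooth :: "(real \<Rightarrow> real) \<Rightarrow> complex \<Rightarrow> complex" where
  "dmean_smooth g m = gauss_moment g 1 1 m - m * gauss_moment g 0 1 m"

text \<open>The second derivative: the weight is the Hermite polynomial
  \<open>(u - m)\<^sup>2 - 1\<close>, expanded in powers of \<open>u\<close>.\<close>

definition dmean2_smooth :: "(real \<Rightarrow> real) \<Rightarrow> complex \<Rightarrow> complex" where
  "dmean2_smooth g m = gauss_moment g 2 1 m - 2 * m * gauss_moment g 1 1 m + (m\<^sup>2 - 1) * gauss_moment g 0 1 m"

text \<open>The third claim is the heat equation. Up to a constant,
  \<open>\<kappa> * gauss_moment g 0 \<kappa> m\<close> is the mean of \<open>g\<close> under the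
  normal law with mean \<open>m / \<kappa>\<close> and variance \<open>1 / \<kappa>\<^sup>2\<close>.
  At \<kappa> = 1 these parameters move at rates \<open>- m\<close> and -2, and the derivative in
  the variance is half the second derivative in the mean.\<close>

lemma gauss_smooth_derivs:
  assumes "g \<in> borel_measurable borel" "\<And>u. \<bar>g u\<bar> \<le> C"
  shows "(gauss_moment g 0 1 has_field_derivative dmean_smooth g m) (at m)"
    and "(dmean_smooth g has_field_derivative dmean2_smooth g m) (at m)"
    and "((\<lambda>\<kappa>. \<kappa> * gauss_moment g 0 \<kappa> m) has_field_derivative - (m * dmean_smooth g m + dmean2_smooth g m)) (at 1)"
proof -
  note d = gauss_moment_deriv_mean[OF assms, of 1, simplified]
  show "(gauss_moment g 0 1 has_field_derivative dmean_smooth g m) (at m)"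
    unfolding dmean_smooth_def by (auto intro!: d derivative_eq_intros)
  show "(dmean_smooth g has_field_derivative dmean2_smooth g m) (at m)"
    unfolding dmean_smooth_def[abs_def] dmean2_smooth_def
    by (rule derivative_eq_intros d refl)+ (simp add: numeral_2_eq_2 algebra_simps)
  show "((\<lambda>\<kappa>. \<kappa> * gauss_moment g 0 \<kappa> m) has_field_derivative - (m * dmean_smooth g m + dmean2_smooth g m)) (at 1)"
    by (rule derivative_eq_intros gauss_moment_deriv_scale[OF assms] refl)+
      (simp add: dmean_smooth_def dmean2_smooth_def numeral_2_eq_2 algebra_simps power2_eq_square)
qed

section \<open>The smoothed function along an affine index\<close>

lemma gauss_smooth_affine_derivs:
  assumes "g \<in> borel_measurable borel" "\<And>u. \<bar>g u\<bar> \<le> C"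
  shows "((\<lambda>x. gauss_moment g 0 1 (b0 + b1 * x)) has_field_derivative b1 * dmean_smooth g (b0 + b1 * x)) (at x)"
    and "((\<lambda>x. b1 * dmean_smooth g (b0 + b1 * x)) has_field_derivative b1\<^sup>2 * dmean2_smooth g (b0 + b1 * x)) (at x)"
proof -
  have a: "((\<lambda>x. b0 + b1 * x) has_field_derivative b1) (at x)"
    by (auto intro!: derivative_eq_intros)
  show "((\<lambda>x. gauss_moment g 0 1 (b0 + b1 * x)) has_field_derivative b1 * dmean_smooth g (b0 + b1 * x)) (at x)"
    using DERIV_chain2[OF gauss_smooth_derivs(1)[OF assms] a] by (simp add: mult.commute)
  show "((\<lambda>x. b1 * dmean_smooth g (b0 + b1 * x)) has_field_derivative b1\<^sup>2 * dmean2_smooth g (b0 + b1 * x)) (at x)"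
    using DERIV_cmult[OF DERIV_chain2[OF gauss_smooth_derivs(2)[OF assms] a], of b1]
    by (simp add: mult.commute mult.assoc power2_eq_square)
qed

lemma dmean_smooth_holomorphic:
  assumes "g \<in> borel_measurable borel" "\<And>u. \<bar>g u\<bar> \<le> C"
  shows "(\<lambda>x. b1 * dmean_smooth g (b0 + b1 * x)) holomorphic_on UNIV"
    and "(\<lambda>x. b1\<^sup>2 * dmean2_smooth g (b0 + b1 * x)) holomorphic_on UNIV"
proof -
  show *: "(\<lambda>x. b1 * dmean_smooth g (b0 + b1 * x)) holomorphic_on UNIV"
    using gauss_smooth_affine_derivs(2)[OF assms] unfolding holomorphic_on_def field_differentiable_def by auto
  have "deriv (\<lambda>x. b1 * dmean_smooth g (b0 + b1 * x)) = (\<lambda>x. b1\<^sup>2 * dmean2_smooth g (b0 + b1 * x))"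
    using DERIV_imp_deriv[OF gauss_smooth_affine_derivs(2)[OF assms]] by blast
  then show "(\<lambda>x. b1\<^sup>2 * dmean2_smooth g (b0 + b1 * x)) holomorphic_on UNIV"
    using holomorphic_deriv[OF * open_UNIV] by simp
qed

lemma gauss_smooth_affine_entire:
  assumes "g \<in> borel_measurable borel" "\<And>u. \<bar>g u\<bar> \<le> C"
  shows "(\<lambda>x. gauss_moment g 0 1 (b0 + b1 * x)) holomorphic_on UNIV"
  using gauss_smooth_affine_derivs(1)[OF assms] unfolding holomorphic_on_def field_differentiable_def by auto

text \<open>Agreement in the mean direction equates the derivatives of both structures, and
  agreement in the scale direction then gives a second equation in the same derivatives. Its terms
  with coefficient \<open>d\<close> cancel, so constant coefficients remain, and they must
  vanish.\<close>

lemma location_scale_identification: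
  fixes b0 b1 b0' b1' :: real
  assumes g: "g \<in> borel_measurable borel" "\<And>u. \<bar>g u\<bar> \<le> C"
    and g': "g' \<in> borel_measurable borel" "\<And>u. \<bar>g' u\<bar> \<le> C'"
    and b1: "b1 \<noteq> 0" "b1' \<noteq> 0" and \<epsilon>: "0 < \<epsilon>"
    and eq: "\<And>d \<kappa>. \<bar>d - d0\<bar> < \<epsilon> \<Longrightarrow> \<bar>\<kappa> - 1\<bar> < \<epsilon> \<Longrightarrow>
        gauss_moment g 0 (of_real \<kappa>) (of_real (b0 + b1 * d)) = gauss_moment g' 0 (of_real \<kappa>) (of_real (b0' + b1' * d))"
    and nonexp: "\<not> exponential_on U (\<lambda>d. Re (gauss_moment g 0 1 (of_real (b0 + b1 * d))))"
    and nonaff: "\<not> affine_on U (\<lambda>d. Re (gauss_moment g 0 1 (of_real (b0 + b1 * d))))"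
  shows "b0 / b1 = b0' / b1'" "b1\<^sup>2 = b1'\<^sup>2"
proof -
  define F F1 F2 where "F x = gauss_moment g 0 1 (b0 + b1 * x)"
    and "F1 x = b1 * dmean_smooth g (b0 + b1 * x)" and "F2 x = (of_real b1)\<^sup>2 * dmean2_smooth g (b0 + b1 * x)" for x :: complex
  \<comment> \<open>Primes mark the second structure; derivatives carry the numbers 1 and 2.\<close>
  define F' F1' F2' where "F' x = gauss_moment g' 0 1 (b0' + b1' * x)"
    and "F1' x = b1' * dmean_smooth g' (b0' + b1' * x)" and "F2' x = (of_real b1')\<^sup>2 * dmean2_smooth g' (b0' + b1' * x)" for x :: complex
  have dF: "(F has_field_derivative F1 x) (at x)" "(F1 has_field_derivative F2 x) (at x)" for x
    unfolding F_def F1_def F2_def by (rule gauss_smooth_affine_derivs[OF g])+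
  have dF': "(F' has_field_derivative F1' x) (at x)" "(F1' has_field_derivative F2' x) (at x)" for x
    unfolding F'_def F1'_def F2'_def by (rule gauss_smooth_affine_derivs[OF g'])+
  have "F x - F' x = 0" for x
  proof (rule entire_eq_0_if_zeros_on_reals[where f = "\<lambda>x. F x - F' x", OF _ islimpt_ball_real[OF \<epsilon>]])
    show "(\<lambda>x. F x - F' x) holomorphic_on UNIV"
      unfolding F_def F'_def by (intro holomorphic_on_diff gauss_smooth_affine_entire[OF g] gauss_smooth_affine_entire[OF g'])
    fix d assume "d \<in> ball d0 \<epsilon>"
    then show "F (of_real d) - F' (of_real d) = 0"
      using eq[of d 1] \<epsilon> by (simp add: F_def F'_def dist_real_def abs_minus_commute)
  qed
  then have "F = F'" by auto
  then have F1: "F1 = F1'" using DERIV_unique[OF dF(1)] dF'(1) by auto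
  then have F2: "F2 = F2'" using DERIV_unique[OF dF(2)] dF'(2) by auto
  define A B where "A = b0 / b1 - b0' / b1'" and "B = 1 / b1\<^sup>2 - 1 / b1'\<^sup>2"
  \<comment> \<open>The scale derivative is rewritten from derivatives in the mean to derivatives in
    \<open>x\<close>, each of which contributes a factor \<open>c1\<close>.\<close>
  have scale: "m * dmean_smooth h m + dmean2_smooth h m = (c0 / c1 + x) * (c1 * dmean_smooth h m) + (1 / c1\<^sup>2) * (c1\<^sup>2 * dmean2_smooth h m)"
    if "m = c0 + c1 * x" "c1 \<noteq> 0" for m c0 c1 x :: complex and h
    using that by (simp add: field_simps)
  have "A * F1 x + B * F2 x = 0" for x
  proof (rule entire_eq_0_if_zeros_on_reals[where f = "\<lambda>x. A * F1 x + B * F2 x", OF _ islimpt_ball_real[OF \<epsilon>]])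
    show "(\<lambda>x. A * F1 x + B * F2 x) holomorphic_on UNIV"
      unfolding F1_def F2_def by (intro holomorphic_intros dmean_smooth_holomorphic[OF g])
    fix d assume d: "d \<in> ball d0 \<epsilon>"
    have "- ((b0 + b1 * d) * dmean_smooth g (b0 + b1 * d) + dmean2_smooth g (b0 + b1 * d))
        = - ((b0' + b1' * d) * dmean_smooth g' (b0' + b1' * d) + dmean2_smooth g' (b0' + b1' * d))"
    proof (rule has_field_derivative_eq_if_eq_on_reals[OF _ _ \<epsilon>, of _ _ 1, simplified of_real_1])
      show "((\<lambda>\<kappa>. \<kappa> * gauss_moment g 0 \<kappa> (b0 + b1 * d)) has_field_derivative
          - ((b0 + b1 * d) * dmean_smooth g (b0 + b1 * d) + dmean2_smooth g (b0 + b1 * d))) (at 1)"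
        by (rule gauss_smooth_derivs(3)[OF g])
      show "((\<lambda>\<kappa>. \<kappa> * gauss_moment g' 0 \<kappa> (b0' + b1' * d)) has_field_derivative
          - ((b0' + b1' * d) * dmean_smooth g' (b0' + b1' * d) + dmean2_smooth g' (b0' + b1' * d))) (at 1)"
        by (rule gauss_smooth_derivs(3)[OF g'])
    qed (use eq d in \<open>simp add: dist_real_def abs_minus_commute\<close>)
    then have "(b0 / b1 + d) * F1 d + (1 / (of_real b1)\<^sup>2) * F2 d = (b0' / b1' + d) * F1' d + (1 / (of_real b1')\<^sup>2) * F2' d"
      unfolding neg_equal_iff_equal
      using scale[of "b0 + b1 * d" b0 b1 d g] scale[of "b0' + b1' * d" b0' b1' d g'] b1
      by (simp add: F1_def F2_def F1'_def F2'_def)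
    then show "A * F1 d + B * F2 d = 0"
      unfolding F1[symmetric] F2[symmetric] by (simp add: A_def B_def algebra_simps)
  qed
  \<comment> \<open>Since \<open>A\<close> and \<open>B\<close> are real, the real parts on the real
    line satisfy the same differential equation.\<close>
  then have "Re (A * F1 x + B * F2 x) = 0" for x by simp
  then have "A * Re (F1 x) + B * Re (F2 x) = 0" for x by simp
  then have "A = 0 \<and> B = 0"
    using exponential_or_affine_if_ode[OF has_real_derivative_Re_of_real[OF dF(1)]
        has_real_derivative_Re_of_real[OF dF(2)], of A B U] nonexp nonaff
    by (auto simp: F_def)
  then show "b0 / b1 = b0' / b1'" "b1\<^sup>2 = b1'\<^sup>2"
    using b1 by (auto simp: A_def B_def)
qed


section \<open>The outside option probability with a normal latent index\<close>

text \<open>The function \<open>G\<^sub>z\<close>, the joint c.d.f. of the shocks along the line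
  through \<open>- z\<close>. Rescaling \<open>z\<close> is the same as rescaling
  \<open>v\<close>.\<close>

definition ray_cdf :: "('j::finite, 'k::finite) dc_model \<Rightarrow> real^'k \<Rightarrow> real^'j \<Rightarrow> real \<Rightarrow> real" where
  "ray_cdf S w z v = eps_cdf S w (\<chi> j. - z $ j * v)"

locale normal_latent =
  fixes S :: "('j::finite, 'k::finite) dc_model" and w :: "real^'k"
  assumes prob_law: "prob_space (law S w)" and sets_law: "sets (law S w) = sets borel"
    and Lat_normal: "distributed (law S w) lborel Lat std_normal_density"
begin

sublocale shock: prob_space "distr (law S w) borel Shock"
  by (rule prob_space.prob_space_distr[OF prob_law])
    (simp add: measurable_cong_sets[OF sets_law refl] measurable_outcome)

lemma lat_law_eq: "lat_law S w = density lborel std_normal_density"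
proof -
  have "lat_law S w = distr (law S w) lborel Lat"
    unfolding lat_law_def by (rule distr_cong) simp_all
  then show ?thesis using distributed_distr_eq_density[OF Lat_normal] by simp
qed

lemma v_law_eq:
  "v_law S (d, z, w) = density lborel (normal_density (beta0 S w + beta1 S w * d) 1)"
proof -
  let ?m = "beta0 S w + beta1 S w * d"
  have "distributed (law S w) lborel (\<lambda>\<omega>. ?m + 1 * Lat \<omega>) (normal_density (?m + 1 * 0) (\<bar>1\<bar> * 1))"
    by (rule prob_space.normal_density_affine[OF prob_law Lat_normal]) simp_all
  from distributed_distr_eq_density[OF this]
  have "distr (law S w) lborel (\<lambda>\<omega>. ?m + Lat \<omega>) = density lborel (normal_density ?m 1)" by simp
  moreover have "v_law S (d, z, w) = distr (law S w) borel (\<lambda>\<omega>. ?m + Lat \<omega>)"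
    unfolding v_law_def lat_law_def prod.case
    by (subst distr_distr) (simp_all add: comp_def measurable_cong_sets[OF sets_law refl] measurable_outcome)
  moreover have "\<dots> = distr (law S w) lborel (\<lambda>\<omega>. ?m + Lat \<omega>)"
    by (rule distr_cong) simp_all
  ultimately show ?thesis by simp
qed

text \<open>The value at \<open>v\<close> is the measure of the \<open>v\<close>-section of the
  closed set \<open>?Q\<close>, and measures of sections depend measurably on the point.\<close>

lemma ray_cdf_measurable [measurable]: "ray_cdf S w z \<in> borel_measurable borel"
proof -
  let ?Q = "{(v, u). \<forall>j. u $ j \<le> - z $ j * v}"
  have "?Q = (\<Inter>j. {y :: real \<times> (real^'j). snd y $ j \<le> - z $ j * fst y})" by auto
  also have "closed \<dots>" by (intro closed_INT ballI closed_Collect_le continuous_intros)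
  finally have "?Q \<in> sets borel" by (rule borel_closed)
  then have "?Q \<in> sets (borel \<Otimes>\<^sub>M distr (law S w) borel Shock)"
    by (simp add: borel_prod[symmetric] cong: sets_pair_measure_cong)
  from borel_measurable_enn2real[OF shock.finite_measure_cut_measurable[OF this]]
  show ?thesis
    by (simp add: ray_cdf_def[abs_def] eps_cdf_def measure_def vimage_def)
qed

lemma ray_cdf_bounds: "0 \<le> ray_cdf S w z v" "ray_cdf S w z v \<le> 1"
  by (simp_all add: ray_cdf_def eps_cdf_def)

lemma abs_ray_cdf_le: "\<bar>ray_cdf S w z v\<bar> \<le> 1"
  using ray_cdf_bounds[of z v] by simp

lemma p0_eq_integral:
  "p0 S (d, z, w) = (\<integral>e. ray_cdf S w z (beta0 S w + beta1 S w * d + e) * std_normal_density e \<partial>lborel)"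
proof -
  have "p0 S (d, z, w) = (\<integral>e. ray_cdf S w z (beta0 S w + beta1 S w * d + e) \<partial>density lborel std_normal_density)"
    unfolding p0_def prod.case lat_law_eq ray_cdf_def ..
  also have "\<dots> = (\<integral>e. std_normal_density e *\<^sub>R ray_cdf S w z (beta0 S w + beta1 S w * d + e) \<partial>lborel)"
    by (rule integral_density) auto
  finally show ?thesis by (simp add: mult.commute)
qed

text \<open>The substitution \<open>e = \<kappa> * u - m\<close>, with \<open>m\<close> the mean
  index, moves \<kappa> from the argument of the c.d.f. into the normal kernel. Variation of
  \<open>z\<close> along its ray thus becomes variation of scale, with Jacobian \<kappa>.\<close>

lemma p0_scaled_eq_gauss_moment:
  assumes "0 < \<kappa>"
  shows "of_real (p0 S (d, (1 / \<kappa>) *\<^sub>R z, w)) =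
    of_real (\<kappa> / sqrt (2 * pi)) * gauss_moment (ray_cdf S w z) 0 (of_real \<kappa>) (of_real (beta0 S w + beta1 S w * d))"
proof -
  let ?m = "beta0 S w + beta1 S w * d"
  have "ray_cdf S w ((1 / \<kappa>) *\<^sub>R z) (?m + (- ?m + \<kappa> * u)) = ray_cdf S w z u" for u
    using assms by (simp add: ray_cdf_def)
  then have "p0 S (d, (1 / \<kappa>) *\<^sub>R z, w) = \<kappa> * (\<integral>u. ray_cdf S w z u * std_normal_density (- ?m + \<kappa> * u) \<partial>lborel)"
    unfolding p0_eq_integral using assms
    by (subst lborel_integral_real_affine[where c = \<kappa> and t = "- ?m"]) simp_all
  also have "\<dots> = \<kappa> / sqrt (2 * pi) * (\<integral>u. ray_cdf S w z u * exp (- (\<kappa> * u - ?m)\<^sup>2 / 2) \<partial>lborel)"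
  proof -
    have "- ?m + \<kappa> * u = \<kappa> * u - ?m" for u by simp
    then show ?thesis unfolding std_normal_density_def by (simp only: mult.left_commute) simp
  qed
  finally show ?thesis
    unfolding gauss_moment_of_real by simp
qed

lemma p0_eq_gauss_moment:
  "p0 S (d, z, w) = Re (gauss_moment (ray_cdf S w z) 0 1 (of_real (beta0 S w + beta1 S w * d))) / sqrt (2 * pi)"
  using arg_cong[OF p0_scaled_eq_gauss_moment[of 1 d z], of Re] by simp

section \<open>Monotonicity in positive directions\<close>

lemma ray_cdf_antimono:
  assumes "\<And>j. 0 < z $ j" "u \<le> v"
  shows "ray_cdf S w z v \<le> ray_cdf S w z u"
proof -
  have cl: "closed {x :: real^'j. \<forall>j. x $ j \<le> a $ j}" for a
    by (intro closed_Collect_all closed_Collect_le continuous_intros)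
  have "z $ j * u \<le> z $ j * v" for j using assms by (simp add: less_imp_le mult_left_mono)
  then show ?thesis
    unfolding ray_cdf_def eps_cdf_def
    by (intro shock.finite_measure_mono) (auto intro: order_trans simp: borel_closed cl)
qed

text \<open>Continuity of the shock distribution along orthants that shrink to the empty set or grow
  to the whole space.\<close>

lemma ray_cdf_limits:
  assumes z: "\<And>j. 0 < z $ j"
  shows "(\<lambda>n. ray_cdf S w z (real n)) \<longlonglongrightarrow> 0" "(\<lambda>n. ray_cdf S w z (- real n)) \<longlonglongrightarrow> 1"
proof -
  define A where "A v = {x :: real^'j. \<forall>j. x $ j \<le> - z $ j * v}" for v
  have ray: "ray_cdf S w z v = measure (distr (law S w) borel Shock) (A v)" for v
    by (simp add: ray_cdf_def eps_cdf_def A_def)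
  have cl: "closed (A v)" for v
    unfolding A_def by (intro closed_Collect_all closed_Collect_le continuous_intros)
  have mono: "A v \<subseteq> A u" if "u \<le> v" for u v
  proof -
    have "z $ j * u \<le> z $ j * v" for j using z that by (simp add: less_imp_le mult_left_mono)
    then show ?thesis by (auto simp: A_def intro: order_trans)
  qed
  have "(\<Inter>n. A (real n)) = {}"
  proof (rule equals0I)
    fix x assume x: "x \<in> (\<Inter>n. A (real n))"
    \<comment> \<open>A single coordinate suffices to empty the intersection.\<close>
    fix j :: 'j
    obtain n :: nat where "- x $ j < real n * z $ j"
      using reals_Archimedean3[OF z] by blast
    moreover have "x $ j \<le> - z $ j * real n" using x by (auto simp: A_def)
    ultimately show False by (simp add: mult.commute)
  qed
  moreover have "(\<lambda>n. measure (distr (law S w) borel Shock) (A (real n)))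
      \<longlonglongrightarrow> measure (distr (law S w) borel Shock) (\<Inter>n. A (real n))"
    by (rule shock.finite_Lim_measure_decseq) (auto simp: decseq_def borel_closed cl mono)
  ultimately show "(\<lambda>n. ray_cdf S w z (real n)) \<longlonglongrightarrow> 0" by (simp add: ray)
  have "(\<Union>n. A (- real n)) = UNIV"
  proof -
    have "\<exists>n. x \<in> A (- real n)" for x
    proof -
      have "\<exists>n. x $ j < real n * z $ j" for j
        using reals_Archimedean3[OF z] by blast
      \<comment> \<open>All coordinates have to be dominated at once; there are finitely many, so
        the maximum of their bounds works.\<close>
      then obtain N :: "'j \<Rightarrow> nat" where N: "\<And>j. x $ j < real (N j) * z $ j" by metis
      define M where "M = Max (range N)"
      have "x $ j \<le> z $ j * real M" for j
      proof -
        have "real (N j) * z $ j \<le> real M * z $ j"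
          using z[of j] by (intro mult_right_mono) (auto simp: M_def)
        with N[of j] show ?thesis by (simp add: mult.commute)
      qed
      then have "x \<in> A (- real M)" by (simp add: A_def)
      then show ?thesis ..
    qed
    then show ?thesis by blast
  qed
  moreover have "(\<lambda>n. measure (distr (law S w) borel Shock) (A (- real n)))
      \<longlonglongrightarrow> measure (distr (law S w) borel Shock) (\<Union>n. A (- real n))"
    by (rule shock.finite_Lim_measure_incseq) (auto simp: incseq_def borel_closed cl mono)
  ultimately show "(\<lambda>n. ray_cdf S w z (- real n)) \<longlonglongrightarrow> 1"
    using shock.prob_space by (simp add: ray)
qed

text \<open>An almost everywhere constant value \<open>c\<close> is attained in every unit interval.
  Monotonicity then places the values at \<open>- n\<close> below \<open>c\<close> and those at
  \<open>n\<close> above it, and the limits give \<open>1 \<le> c \<le> 0\<close>.\<close>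

lemma ray_cdf_not_AE_const:
  assumes z: "\<And>j. 0 < z $ j"
  shows "\<not> (AE v in lborel. ray_cdf S w z v = c)"
proof
  assume AE: "AE v in lborel. ray_cdf S w z v = c"
  have ex: "\<exists>v\<in>{a<..<a + 1}. ray_cdf S w z v = c" for a :: real
  proof (rule ccontr)
    assume "\<not> ?thesis"
    then have "\<And>v. v \<in> {a<..<a + 1} \<Longrightarrow> ray_cdf S w z v \<noteq> c" by blast
    then have "AE v in lborel. v \<notin> {a<..<a + 1}"
      using AE by (auto elim!: eventually_mono)
    then have "{a<..<a + 1} \<in> null_sets lborel"
      by (subst AE_iff_null_sets) auto
    then show False by (simp add: null_sets_def)
  qed
  have "ray_cdf S w z (- real n) \<le> c" for n
    using ex[of "- real n - 1"] ray_cdf_antimono[OF z, of _ "- real n"] by auto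
  then have "1 \<le> c" by (intro LIMSEQ_le_const2[OF ray_cdf_limits(2)[OF z]]) auto
  moreover have "c \<le> ray_cdf S w z (real n)" for n
    using ex[of "real n"] ray_cdf_antimono[OF z, of "real n"] by auto
  then have "c \<le> 0" by (intro LIMSEQ_le_const[OF ray_cdf_limits(1)[OF z]]) auto
  ultimately show False by simp
qed

text \<open>Local constancy would make the normal means of \<open>ray_cdf S w z v - c\<close> vanish
  for an interval of locations, so completeness would force the c.d.f. to be constant almost
  everywhere.\<close>

lemma p0_not_constant_near:
  assumes z: "\<And>j. 0 < z $ j" and "0 < \<epsilon>" and b1: "beta1 S w \<noteq> 0"
  shows "\<exists>d\<in>ball d0 \<epsilon>. p0 S (d, z, w) \<noteq> c"
proof (rule ccontr)
  assume "\<not> ?thesis"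
  then have const: "p0 S (d, z, w) = c" if "d \<in> ball d0 \<epsilon>" for d using that by blast
  have "AE v in lborel. ray_cdf S w z v - c = 0"
  proof (rule normal_location_family_complete)
    show "\<bar>ray_cdf S w z v - c\<bar> \<le> 1 + \<bar>c\<bar>" for v
      using abs_triangle_ineq4[of "ray_cdf S w z v" c] abs_ray_cdf_le[of z v] by linarith
    show "(beta0 S w + beta1 S w * d0) islimpt (\<lambda>d. beta0 S w + beta1 S w * d) ` ball d0 \<epsilon>"
      by (rule islimpt_affine_image[OF islimpt_ball_real[OF \<open>0 < \<epsilon>\<close>] b1])
    fix m assume "m \<in> (\<lambda>d. beta0 S w + beta1 S w * d) ` ball d0 \<epsilon>"
    then obtain d where d: "d \<in> ball d0 \<epsilon>" "m = beta0 S w + beta1 S w * d" by blast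
    have "(\<integral>u. ray_cdf S w z u * normal_density m 1 u \<partial>lborel) = p0 S (d, z, w)"
      unfolding p0_eq_gauss_moment d(2) gauss_moment_1_of_real by simp
    then have "(\<integral>u. ray_cdf S w z u * normal_density m 1 u \<partial>lborel) = c" using const d by simp
    moreover have "integrable lborel (\<lambda>u. ray_cdf S w z u * normal_density m 1 u)"
      by (rule integrable_bounded_times_normal_density[OF ray_cdf_measurable abs_ray_cdf_le]) simp
    ultimately show "(\<integral>u. (ray_cdf S w z u - c) * normal_density m 1 u \<partial>lborel) = 0"
      by (simp add: left_diff_distrib)
  qed auto
  then show False using ray_cdf_not_AE_const[OF z, of c] by simp
qed

lemma p0_le_if_index_le:
  assumes z: "\<And>j. 0 < z $ j" and le: "beta1 S w * d \<le> beta1 S w * d'"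
  shows "p0 S (d', z, w) \<le> p0 S (d, z, w)"
  unfolding p0_eq_integral
proof (rule integral_mono)
  show "integrable lborel (\<lambda>e. ray_cdf S w z (beta0 S w + beta1 S w * d + e) * std_normal_density e)" for d
    by (rule integrable_bounded_times_normal_density[OF _ abs_ray_cdf_le]) simp_all
  then show "integrable lborel (\<lambda>e. ray_cdf S w z (beta0 S w + beta1 S w * d + e) * std_normal_density e)" .
  show "ray_cdf S w z (beta0 S w + beta1 S w * d' + e) * std_normal_density e
      \<le> ray_cdf S w z (beta0 S w + beta1 S w * d + e) * std_normal_density e" for e
    by (intro mult_right_mono ray_cdf_antimono z) (use le in auto)
qed

text \<open>The means of these unit-variance normal laws form an affine image of \<open>D\<close>,
  which inherits a limit point because the slope is nonzero. Lebesgue null sets are null for each of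
  the laws.\<close>

lemma boundedly_complete_v_law:
  assumes "d islimpt D" "beta1 S w \<noteq> 0"
  shows "boundedly_complete (\<lambda>d. v_law S (d, z, w)) D"
  unfolding boundedly_complete_def
proof (intro allI impI ballI)
  fix g :: "real \<Rightarrow> real" and i
  assume g: "g \<in> borel_measurable borel" and "bounded (range g)"
    and 0: "\<forall>i\<in>D. (\<integral>t. g t \<partial>v_law S (i, z, w)) = 0"
  then obtain C where C: "\<And>u. \<bar>g u\<bar> \<le> C"
    unfolding bounded_iff by auto
  have "AE t in lborel. g t = 0"
  proof (rule normal_location_family_complete[OF g C islimpt_affine_image[OF assms]])
    fix m assume "m \<in> (\<lambda>d. beta0 S w + beta1 S w * d) ` D"
    then obtain d where d: "d \<in> D" "m = beta0 S w + beta1 S w * d" by blast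
    have "(\<integral>t. g t \<partial>v_law S (d, z, w)) = (\<integral>t. normal_density m 1 t *\<^sub>R g t \<partial>lborel)"
      unfolding v_law_eq d(2) by (rule integral_density) (use g in auto)
    with 0 d(1) show "(\<integral>u. g u * normal_density m 1 u \<partial>lborel) = 0"
      by (simp add: mult.commute)
  qed
  then show "AE t in v_law S (i, z, w). g t = 0"
    unfolding v_law_eq by (subst AE_density) (auto elim: eventually_mono)
qed

end


section \<open>Identification\<close>

lemma normal_latent_if_admissible:
  assumes "admissible W R S" "w \<in> W"
  shows "normal_latent S w"
  using bspec[OF assms(1)[unfolded admissible_def] assms(2)]
  by (elim conjE) (rule normal_latent.intro)

text \<open>Continuity of \<open>(d', \<kappa>) \<mapsto> (d', (1 / \<kappa>) *\<^sub>R z)\<close>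
  at \<open>(d, 1)\<close>. It turns an interior point into room for varying location and scale
  together.\<close>

lemma interior_scaled_segment:
  fixes z :: "real^'j::finite" and A :: "(real \<times> (real^'j)) set"
  assumes "(d, z) \<in> interior A"
  obtains \<epsilon> where "0 < \<epsilon>"
    "\<And>d' \<kappa>. \<bar>d' - d\<bar> < \<epsilon> \<Longrightarrow> \<bar>\<kappa> - 1\<bar> < \<epsilon> \<Longrightarrow> 0 < \<kappa> \<and> (d', (1 / \<kappa>) *\<^sub>R z) \<in> A"
proof -
  let ?f = "\<lambda>y :: real \<times> real. (fst y, (1 / snd y) *\<^sub>R z)"
  have "isCont ?f (d, 1)" by (intro continuous_intros) simp
  then have "(?f \<longlongrightarrow> ?f (d, 1)) (nhds (d, 1))"
    unfolding isCont_def by (rule tendsto_at_iff_tendsto_nhds[of ?f "(d, 1)", THEN iffD1])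
  then have "eventually (\<lambda>y. ?f y \<in> interior A) (nhds (d, 1))"
    using assms by (intro topological_tendstoD) auto
  then obtain e where e: "0 < e" "\<And>y. dist y (d, 1) < e \<Longrightarrow> ?f y \<in> interior A"
    unfolding eventually_nhds_metric by blast
  show thesis
  \<comment> \<open>The half allows for the sum of two deviations, and the cap 1 keeps \<kappa>
    positive.\<close>
  proof (rule that[of "min (e / 2) 1"])
    fix d' \<kappa> :: real assume d': "\<bar>d' - d\<bar> < min (e / 2) 1" and \<kappa>: "\<bar>\<kappa> - 1\<bar> < min (e / 2) 1"
    have "dist (d', \<kappa>) (d, 1) \<le> \<bar>d' - d\<bar> + \<bar>\<kappa> - 1\<bar>"
      unfolding dist_Pair_Pair dist_real_def by (rule sqrt_sum_squares_le_sum_abs[THEN order_trans]) simp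
    also have "\<dots> < e" using d' \<kappa> by simp
    finally have "(d', (1 / \<kappa>) *\<^sub>R z) \<in> A" using e(2)[of "(d', \<kappa>)"] interior_subset[of A] by auto
    moreover have "0 < \<kappa>" using \<kappa> by linarith
    ultimately show "0 < \<kappa> \<and> (d', (1 / \<kappa>) *\<^sub>R z) \<in> A" by simp
  qed (use e(1) in simp)
qed

lemma coefficients_identified:
  fixes S S' :: "('j::finite, 'k::finite) dc_model"
  assumes S: "admissible W R S" and S': "admissible W R S'" and w: "w \<in> W"
    and eq: "\<And>x. x \<in> X_supp W R \<Longrightarrow> p0 S x = p0 S' x"
  shows "beta0 S w = beta0 S' w" "beta1 S w = beta1 S' w"
proof -
  interpret S: normal_latent S w by (rule normal_latent_if_admissible[OF S w])
  interpret S': normal_latent S' w by (rule normal_latent_if_admissible[OF S' w])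
  have b1: "beta1 S w \<noteq> 0" "beta1 S' w \<noteq> 0" using S S' w by (auto simp: admissible_def)
  have eq_w: "p0 S (d, z, w) = p0 S' (d, z, w)" if "(d, z) \<in> supp (R w)" for d z
    using eq[of "(d, z, w)"] that w by (simp add: X_supp_def)

  obtain d2 z2 U where int2: "(d2, z2) \<in> interior (supp (R w))"
    and U: "\<not> exponential_on U (\<lambda>d'. p0 S (d', z2, w))" "\<not> affine_on U (\<lambda>d'. p0 S (d', z2, w))"
    using S w unfolding admissible_def by blast
  obtain \<epsilon> where \<epsilon>: "0 < \<epsilon>" "\<And>d' \<kappa>. \<bar>d' - d2\<bar> < \<epsilon> \<Longrightarrow> \<bar>\<kappa> - 1\<bar> < \<epsilon> \<Longrightarrow>
      0 < \<kappa> \<and> (d', (1 / \<kappa>) *\<^sub>R z2) \<in> supp (R w)"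
    using interior_scaled_segment[OF int2] by blast
  \<comment> \<open>The relation found near \<open>d2\<close> extends to the whole line, so it
    contradicts the choice of \<open>U\<close> wherever \<open>U\<close> lies.\<close>
  have ratio: "beta0 S w / beta1 S w = beta0 S' w / beta1 S' w \<and> (beta1 S w)\<^sup>2 = (beta1 S' w)\<^sup>2"
  proof -
    let ?P = "\<lambda>d. Re (gauss_moment (ray_cdf S w z2) 0 1 (of_real (beta0 S w + beta1 S w * d)))"
    have p0_P: "(\<lambda>d. p0 S (d, z2, w)) = (\<lambda>d. 1 / sqrt (2 * pi) * ?P d)"
      by (simp add: S.p0_eq_gauss_moment)
    have "gauss_moment (ray_cdf S w z2) 0 (of_real \<kappa>) (of_real (beta0 S w + beta1 S w * d))
        = gauss_moment (ray_cdf S' w z2) 0 (of_real \<kappa>) (of_real (beta0 S' w + beta1 S' w * d))"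
      if "\<bar>d - d2\<bar> < \<epsilon>" "\<bar>\<kappa> - 1\<bar> < \<epsilon>" for d \<kappa>
      using \<epsilon>(2)[OF that] S.p0_scaled_eq_gauss_moment[of \<kappa> d z2] S'.p0_scaled_eq_gauss_moment[of \<kappa> d z2]
        eq_w[of d "(1 / \<kappa>) *\<^sub>R z2"] by simp
    moreover have "\<not> exponential_on U ?P" "\<not> affine_on U ?P"
      using U exponential_on_cmult[of U ?P] affine_on_cmult[of U ?P] unfolding p0_P by blast+
    ultimately show ?thesis
      using location_scale_identification[OF S.ray_cdf_measurable S.abs_ray_cdf_le
        S'.ray_cdf_measurable S'.abs_ray_cdf_le b1 \<epsilon>(1)] by blast
  qed

  \<comment> \<open>Only the common sign of \<open>beta0\<close> and \<open>beta1\<close> is still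
    open; it is settled at a positive \<open>z\<close>.\<close>
  obtain d1 z1 where int1: "(d1, z1) \<in> interior (supp (R w))" and z1: "\<And>j. 0 < z1 $ j"
    using S w unfolding admissible_def by blast
  obtain \<delta> where \<delta>: "0 < \<delta>" "\<And>d' \<kappa>. \<bar>d' - d1\<bar> < \<delta> \<Longrightarrow> \<bar>\<kappa> - 1\<bar> < \<delta> \<Longrightarrow>
      0 < \<kappa> \<and> (d', (1 / \<kappa>) *\<^sub>R z1) \<in> supp (R w)"
    using interior_scaled_segment[OF int1] by blast
  have eq1: "p0 S (d, z1, w) = p0 S' (d, z1, w)" if "d \<in> ball d1 \<delta>" for d
    using eq_w[of d z1] \<delta>(2)[of d 1] \<delta>(1) that by (simp add: dist_real_def abs_minus_commute)
  have same_sign: "beta1 S w * beta1 S' w > 0"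
  proof (rule ccontr)
    assume "\<not> ?thesis"
    then have neg: "beta1 S w < 0 \<and> 0 < beta1 S' w \<or> 0 < beta1 S w \<and> beta1 S' w < 0"
      using b1 by (auto simp: not_less mult_le_0_iff)
    \<comment> \<open>With slopes of opposite sign, one structure makes the common probability
      nonincreasing in \<open>d\<close> and the other nondecreasing.\<close>
    have "p0 S (d, z1, w) = p0 S (d1, z1, w)" if "d \<in> ball d1 \<delta>" for d
    proof -
      have "p0 S (x, z1, w) \<le> p0 S (y, z1, w)" if "x \<in> ball d1 \<delta>" "y \<in> ball d1 \<delta>" for x y
      proof (cases "beta1 S w * y \<le> beta1 S w * x")
        case True
        then show ?thesis by (rule S.p0_le_if_index_le[OF z1])
      next
        case False
        then have "beta1 S' w * y \<le> beta1 S' w * x" using neg by (auto simp: mult_le_cancel_left)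
        then show ?thesis using S'.p0_le_if_index_le[OF z1] eq1 that by simp
      qed
      from this[of d d1] this[of d1 d] show ?thesis using that \<delta>(1) by (simp add: order_antisym)
    qed
    then show False using S.p0_not_constant_near[OF z1 \<delta>(1) b1(1)] by blast
  qed
  from ratio have "beta1 S w = beta1 S' w \<or> beta1 S w = - beta1 S' w" by (simp add: power2_eq_iff)
  then show "beta1 S w = beta1 S' w"
    using same_sign not_sum_squares_lt_zero[of "beta1 S' w" 0] by (auto simp: not_less)
  then show "beta0 S w = beta0 S' w" using ratio b1 by simp
qed

theorem proposition3p4:
  fixes W :: "(real^'k) set"
    and R :: "real^'k \<Rightarrow> (real \<times> (real^'j::finite)) measure"
    and K :: "real^'k \<Rightarrow> real^'j \<Rightarrow> real measure"
  assumes "\<And>w. w \<in> W \<Longrightarrow> is_cond_law_d (R w) (K w)"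
  shows "(\<forall>w\<in>W. identified W R (\<lambda>S. beta0 S w) \<and> identified W R (\<lambda>S. beta1 S w)) \<and>
    (\<forall>x \<in> X_supp W R. identified W R (\<lambda>S. cdf (v_law S x))) \<and>
    (\<forall>S. admissible W R S \<longrightarrow>
       (\<forall>(z, w) \<in> ZW_supp W R. (\<exists>d. d islimpt D_supp K z w) \<longrightarrow>
          boundedly_complete (\<lambda>d. v_law S (d, z, w)) (D_supp K z w)))"
proof (intro conjI ballI)
  fix w assume w: "w \<in> W"
  show "identified W R (\<lambda>S. beta0 S w)"
    unfolding identified_def using coefficients_identified(1) w by blast
  show "identified W R (\<lambda>S. beta1 S w)"
    unfolding identified_def using coefficients_identified(2) w by blast
next
  fix x assume "x \<in> X_supp W R"
  then obtain d z w where x: "x = (d, z, w)" and w: "w \<in> W" by (auto simp: X_supp_def)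
  show "identified W R (\<lambda>S. cdf (v_law S x))"
    unfolding identified_def
  proof (intro allI impI)
    fix S S' assume S: "admissible W R S" "admissible W R S'"
      and eq: "\<forall>x \<in> X_supp W R. p0 S x = p0 S' x"
    \<comment> \<open>Both laws are normal with variance 1, and equal coefficients give them the
      same mean.\<close>
    show "cdf (v_law S x) = cdf (v_law S' x)"
      using coefficients_identified[OF S w] eq
      by (simp add: x normal_latent.v_law_eq[OF normal_latent_if_admissible[OF S(1) w]]
          normal_latent.v_law_eq[OF normal_latent_if_admissible[OF S(2) w]])
  qed
next
  show "\<forall>S. admissible W R S \<longrightarrow>
       (\<forall>(z, w) \<in> ZW_supp W R. (\<exists>d. d islimpt D_supp K z w) \<longrightarrow>
          boundedly_complete (\<lambda>d. v_law S (d, z, w)) (D_supp K z w))"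
  proof (intro allI impI ballI, clarify)
    fix S z w d assume S: "admissible W R S" and "(z, w) \<in> ZW_supp W R" and d: "d islimpt D_supp K z w"
    then have w: "w \<in> W" by (simp add: ZW_supp_def)
    have "beta1 S w \<noteq> 0" using S w by (simp add: admissible_def)
    then show "boundedly_complete (\<lambda>d. v_law S (d, z, w)) (D_supp K z w)"
      by (rule normal_latent.boundedly_complete_v_law[OF normal_latent_if_admissible[OF S w] d])
  qed
qed

end
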